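(* In the setting of the context, assume $\sigma_{\mathrm{eff,c}}^2=\boldsymbol{w}_{\mathrm c}^\top BB^\top\boldsymbol{w}_{\mathrm c}>0$ and $\rho_{\mathrm c}=(\boldsymbol{1}^\top\boldsymbol{v}_{\mathrm c})^2/N<1$. Let $\boldsymbol{x}=\boldsymbol{x}^*(\alpha)+\boldsymbol{z}$ with $\boldsymbol{z}\sim\mathcal{N}(\boldsymbol{0},C(\alpha))$, and let $\gamma=\boldsymbol{w}^\top\boldsymbol{x}$. Then, as $\alpha\to\alpha_{\mathrm c}^-$, $$g_1=\operatorname{sgn}(\gamma)\,\frac{\mu_3(\boldsymbol{v}_{\mathrm c})}{\mu_2(\boldsymbol{v}_{\mathrm c})^{3/2}}+o_{\mathbb P}(1),$$ $$g_2\longrightarrow\frac{\mu_4(\boldsymbol{v}_{\mathrm c})}{\mu_2(\boldsymbol{v}_{\mathrm c})^2}\quad\text{in probability},$$ $$I_{\mathrm M}\longrightarrow\frac{N}{W}\,\frac{\boldsymbol{v}_{\mathrm c}^\top PAP\boldsymbol{v}_{\mathrm c}}{\boldsymbol{v}_{\mathrm c}^\top P\boldsymbol{v}_{\mathrm c}}\quad\text{in probability}.$$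
   Context: Setting. $N\ge2$. Consider the It\^o SDE $\mathrm d\boldsymbol{x}=F(\boldsymbol{x};\alpha)\,\mathrm dt+B\,\mathrm d\boldsymbol{W}$ in $\mathbb{R}^N$, with $B\in\mathbb{R}^{N\times m}$ constant, $\boldsymbol{W}$ an $m$-dimensional standard Wiener process, and $F$ sufficiently smooth in $(\boldsymbol{x},\alpha)$ ($C^2$ in a neighborhood of the equilibrium branch, including its endpoint at $\alpha_{\mathrm c}$, suffices). $\boldsymbol{x}^*(\alpha)$ is a branch of equilibria, $F(\boldsymbol{x}^*(\alpha);\alpha)=\boldsymbol{0}$, asymptotically stable for $\alpha<\alpha_{\mathrm c}$, and $M(\alpha)=-\frac{\partial F}{\partial\boldsymbol{x}}\big|_{\boldsymbol{x}=\boldsymbol{x}^*(\alpha)}$. $C=C(\alpha)$ is the stationary covariance of the linearized process $\mathrm d\boldsymbol{z}=-M\boldsymbol{z}\,\mathrm dt+B\,\mathrm d\boldsymbol{W}$, i.e. the solution of $MC+CM^\top=BB^\top$. Regular simple real critical eigenvalue assumption (in force). As $\alpha\to\alpha_{\mathrm c}^-$, $\boldsymbol{x}^*(\alpha)$ has a finite limit. For $\alpha<\alpha_{\mathrm c}$ close to $\alpha_{\mathrm c}$, $M(\alpha)$ is diagonalizable over $\mathbb{C}$ with all eigenvalues of positive real part; the eigenvalue $\lambda_1(\alpha)$ of smallest real part is real and simple, $\lambda_1(\alpha)>0$, $\lambda_1(\alpha)\to0$, and $\operatorname{Re}\lambda_k(\alpha)\ge\delta>0$ for $k=2,\dots,N$,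 with $\delta$ independent of $\alpha$. Real right and left eigenvectors $\boldsymbol{v}(\alpha),\boldsymbol{w}(\alpha)$ are chosen with $M\boldsymbol{v}=\lambda_1\boldsymbol{v}$, $\boldsymbol{w}^\top M=\lambda_1\boldsymbol{w}^\top$, $\|\boldsymbol{v}\|_2=1$, $\boldsymbol{w}^\top\boldsymbol{v}=1$, and they have finite limits $\boldsymbol{v}_{\mathrm c},\boldsymbol{w}_{\mathrm c}$ as $\alpha\to\alpha_{\mathrm c}^-$. Statistics. For $\boldsymbol{u}\in\mathbb{R}^N$: $\bar u=N^{-1}\sum_iu_i$, $\mu_k(\boldsymbol{u})=\frac1N\sum_i(u_i-\bar u)^k$. $A=(A_{ij})\in\mathbb{R}^{N\times N}$ is the fixed adjacency matrix, $W=\sum_{i,j}A_{ij}>0$. Spatial skewness $g_1=\mu_3(\boldsymbol{x})/\mu_2(\boldsymbol{x})^{3/2}$, spatial kurtosis $g_2=\mu_4(\boldsymbol{x})/\mu_2(\boldsymbol{x})^2$, Moran's $I$: $I_{\mathrm M}=\frac{N}{W}\frac{\sum_{i,j}A_{ij}(x_i-\bar x)(x_j-\bar x)}{\sum_i(x_i-\bar x)^2}$. $P=I-\frac1N\boldsymbol{1}\boldsymbol{1}^\top$. $o_{\mathbb P}(1)$ denotes a term converging to $0$ in probability. *)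

theory Defs
  imports "HOL-Probability.Probability"
begin

section \<open>Smoothness and stability\<close>

definition C2_on :: "('a::real_normed_vector) set \<Rightarrow> ('a \<Rightarrow> 'b::real_normed_vector) \<Rightarrow> bool" where
  "C2_on U f \<longleftrightarrow> open U \<and>
    (\<exists>(f' :: 'a \<Rightarrow> 'a \<Rightarrow>\<^sub>L 'b) (f'' :: 'a \<Rightarrow> 'a \<Rightarrow>\<^sub>L 'a \<Rightarrow>\<^sub>L 'b).
       (\<forall>x\<in>U. (f has_derivative blinfun_apply (f' x)) (at x)) \<and>
       (\<forall>x\<in>U. (f' has_derivative blinfun_apply (f'' x)) (at x)) \<and>
       continuous_on U f'')"

definition ode_solution_on ::
    "real set \<Rightarrow> ('a::real_normed_vector \<Rightarrow> 'a) \<Rightarrow> (real \<Rightarrow> 'a) \<Rightarrow> bool" where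
  "ode_solution_on T f x \<longleftrightarrow> (\<forall>t\<in>T. (x has_vector_derivative f (x t)) (at t within T))"

text \<open>Stability is required of solutions on every bounded interval \<open>[0, T)\<close>, so that it also
  constrains solutions that are not known in advance to exist for all times. For a vector field
  that is \<open>C\<^sup>1\<close> near \<open>p\<close> it then implies that solutions starting close to \<open>p\<close> can be continued
  to \<open>[0, \<infinity>)\<close>.\<close>

definition asymptotically_stable :: "('a::real_normed_vector \<Rightarrow> 'a) \<Rightarrow> 'a \<Rightarrow> bool" where
  "asymptotically_stable f p \<longleftrightarrow>
     (\<forall>\<epsilon>>0. \<exists>\<eta>>0. \<forall>T>0. \<forall>x. ode_solution_on {0..<T} f x \<and> dist (x 0) p < \<eta> \<longrightarrow>
        (\<forall>t\<in>{0..<T}. dist (x t) p < \<epsilon>)) \<and>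
     (\<exists>\<eta>>0. \<forall>x. ode_solution_on {0..} f x \<and> dist (x 0) p < \<eta> \<longrightarrow> (x \<longlongrightarrow> p) at_top)"

text \<open>The matrix \<open>M(\<alpha>)\<close>: minus the Jacobian of \<open>F(\<cdot>; \<alpha>)\<close> at the equilibrium \<open>xs \<alpha>\<close>.\<close>

definition stability_matrix ::
    "(real^'n \<Rightarrow> real \<Rightarrow> real^'n) \<Rightarrow> (real \<Rightarrow> real^'n) \<Rightarrow> real \<Rightarrow> real^'n^'n" where
  "stability_matrix F xs \<alpha> = - jacobian (\<lambda>x. F x \<alpha>) (at (xs \<alpha>))"

section \<open>Spectra of real matrices over the complex numbers\<close>

definition complex_matrix :: "real^'n^'m \<Rightarrow> complex^'n^'m" where
  "complex_matrix M = (\<chi> i j. complex_of_real (M $ i $ j))"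

text \<open>The family \<open>l\<close> lists the eigenvalues of \<open>M\<close>, counted with algebraic multiplicity. The
  coordinate index type, which has exactly \<open>N\<close> elements, also serves to index the eigenvalues.\<close>

definition eigenvalue_family :: "complex^'n^'n \<Rightarrow> ('n \<Rightarrow> complex) \<Rightarrow> bool" where
  "eigenvalue_family M l \<longleftrightarrow> (\<forall>t. det (mat t - M) = (\<Prod>k\<in>UNIV. t - l k))"

definition diagonalizable :: "complex^'n^'n \<Rightarrow> bool" where
  "diagonalizable M \<longleftrightarrow>
     (\<exists>(S :: complex^'n^'n) (D :: complex^'n^'n).
        invertible S \<and> (\<forall>i j. i \<noteq> j \<longrightarrow> D $ i $ j = 0) \<and> M = S ** D ** matrix_inv S)"

section \<open>Gaussian vectors and convergence in probability\<close>

definition normal_law :: "real \<Rightarrow> real \<Rightarrow> real measure" where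
  "normal_law m s = (if s = 0 then return borel m else density lborel (normal_density m (sqrt s)))"

text \<open>\<open>X \<sim> N(m, S)\<close>, where \<open>S\<close> may be singular: every linear functional of \<open>X\<close> is normally
  distributed with the corresponding mean and variance.\<close>

definition gaussian_vector ::
    "'w measure \<Rightarrow> ('w \<Rightarrow> real^'n) \<Rightarrow> real^'n \<Rightarrow> real^'n^'n \<Rightarrow> bool" where
  "gaussian_vector \<Omega> X m S \<longleftrightarrow>
     transpose S = S \<and> (\<forall>u. 0 \<le> u \<bullet> (S *v u)) \<and>
     X \<in> borel_measurable \<Omega> \<and>
     (\<forall>u. distr \<Omega> borel (\<lambda>\<omega>. u \<bullet> X \<omega>) = normal_law (u \<bullet> m) (u \<bullet> (S *v u)))"

text \<open>The probability space may depend on the parameter, as only laws are compared.\<close>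

definition tendsto_in_probability ::
    "('i \<Rightarrow> 'w measure) \<Rightarrow> ('i \<Rightarrow> 'w \<Rightarrow> real) \<Rightarrow> real \<Rightarrow> 'i filter \<Rightarrow> bool" where
  "tendsto_in_probability \<Omega> X c G \<longleftrightarrow>
     (\<forall>\<^sub>F i in G. X i \<in> borel_measurable (\<Omega> i)) \<and>
     (\<forall>\<epsilon>>0. ((\<lambda>i. measure (\<Omega> i) {\<omega> \<in> space (\<Omega> i). \<bar>X i \<omega> - c\<bar> > \<epsilon>}) \<longlongrightarrow> 0) G)"

section \<open>Spatial statistics\<close>

definition spatial_mean :: "real^'n \<Rightarrow> real" where
  "spatial_mean u = (\<Sum>i\<in>UNIV. u $ i) / real CARD('n)"

definition spatial_moment :: "nat \<Rightarrow> real^'n \<Rightarrow> real" where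
  "spatial_moment k u = (\<Sum>i\<in>UNIV. (u $ i - spatial_mean u) ^ k) / real CARD('n)"

definition spatial_skewness :: "real^'n \<Rightarrow> real" where
  "spatial_skewness u = spatial_moment 3 u / spatial_moment 2 u powr (3/2)"

definition spatial_kurtosis :: "real^'n \<Rightarrow> real" where
  "spatial_kurtosis u = spatial_moment 4 u / (spatial_moment 2 u)\<^sup>2"

definition total_weight :: "real^'n^'n \<Rightarrow> real" where
  "total_weight A = (\<Sum>i\<in>UNIV. \<Sum>j\<in>UNIV. A $ i $ j)"

definition moran_I :: "real^'n^'n \<Rightarrow> real^'n \<Rightarrow> real" where
  "moran_I A u = real CARD('n) / total_weight A *
     ((\<Sum>i\<in>UNIV. \<Sum>j\<in>UNIV. A $ i $ j * (u $ i - spatial_mean u) * (u $ j - spatial_mean u)) /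
      (\<Sum>i\<in>UNIV. (u $ i - spatial_mean u)\<^sup>2))"

definition centering_matrix :: "real^'n^'n" where
  "centering_matrix = mat 1 - (1 / real CARD('n)) *\<^sub>R (\<chi> i j. 1)"

end

theory Submission
  imports Defs "HOL-Computational_Algebra.Fundamental_Theorem_Algebra"
begin

text \<open>Along the critical direction the variance \<open>w \<bullet> C w = w \<bullet> B B\<^sup>T w / (2 \<lambda>\<^sub>1)\<close> blows up. The
  remainder \<open>Q z\<close> with \<open>Q = I - v w\<^sup>T\<close> has a bounded covariance: \<open>\<Sigma> = Q C Q\<^sup>T\<close> solves the Lyapunov
  equation \<open>M' \<Sigma> + \<Sigma> M'\<^sup>T = Q B B\<^sup>T Q\<^sup>T\<close> of the deflated matrix \<open>M' = M + v w\<^sup>T\<close>, whose limit at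
  \<open>\<alpha>\<^sub>c\<close> still has its spectrum in the open right half-plane, so that its Lyapunov operator is
  invertible. No eigenbasis is needed, which matters because the limit of \<open>M\<close> need not be
  diagonalizable. Hence \<open>x / \<gamma> \<rightarrow> v\<^sub>c\<close> in probability, and the claims follow since the statistics
  are scale invariant, up to the sign of the factor for the skewness, and continuous at \<open>v\<^sub>c\<close>.\<close>

section \<open>Rank-one updates of matrices\<close>

text \<open>The rank-one matrix \<open>a b^T\<close>. The entry type is left general because the
  matrix is formed over the reals and, inside characteristic polynomials, over the complex
  numbers.\<close>

definition outer :: "'a::times^'m \<Rightarrow> 'a^'n \<Rightarrow> 'a^'n^'m" where
  "outer a b = (\<chi> i j. a $ i * b $ j)"

text \<open>Row \<open>j\<close> is \<open>b\<close> itself, so the multiples of \<open>b\<close> in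
  the rows of \<open>K\<close> can be cleared one at a time by row operations. What remains is the
  identity with row \<open>j\<close> replaced by \<open>b\<close>.\<close>

lemma det_replace_row_partial:
  fixes a b :: "'a::field^'n"
  assumes "finite K" "j \<notin> K"
  shows "det (\<chi> i. if i = j then b else if i \<in> K then axis i 1 + a $ i *s b else axis i 1) = b $ j"
  using assms
proof (induction K rule: finite_induct)
  case empty
  \<comment> \<open>Writing \<open>b\<close> as a combination of the rows of the identity puts the
    matrix into the shape of Cramer's lemma.\<close>
  have b: "b = (\<Sum>i\<in>UNIV. b $ i *s row i (mat 1 :: 'a^'n^'n))"
    by (simp add: vec_eq_iff row_def mat_def if_distrib if_distribR cong: if_cong)
  have r: "row i (mat 1 :: 'a^'n^'n) = axis i 1" for i
    by (auto simp: vec_eq_iff row_def mat_def axis_def)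
  have "det ((\<chi> i. if i = j then (\<Sum>i\<in>UNIV. b $ i *s row i (mat 1 :: 'a^'n^'n)) else row i (mat 1)) :: 'a^'n^'n)
      = b $ j * det (mat 1 :: 'a^'n^'n)"
    by (rule cramer_lemma_transpose)
  then show ?case unfolding b[symmetric] by (simp add: r cong: if_cong)
next
  case (insert k K)
  let ?A = "\<chi> i. if i = j then b else if i \<in> K then axis i 1 + a $ i *s b else axis i 1"
  have "(\<chi> i. if i = j then b else if i \<in> insert k K then axis i 1 + a $ i *s b else axis i 1)
      = (\<chi> i. if i = k then row k ?A + a $ k *s row j ?A else row i ?A)"
    using insert by (auto simp: vec_eq_iff row_def)
  moreover have "det (\<chi> i. if i = k then row k ?A + a $ k *s row j ?A else row i ?A) = det ?A"
    using insert by (intro det_row_operation) auto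
  ultimately show ?case using insert by auto
qed

text \<open>The rank-one term is switched on row by row. By linearity in row \<open>j\<close>, each
  new row adds \<open>a $ j\<close> times the determinant with that row replaced by
  \<open>b\<close>, which is \<open>b $ j\<close>.\<close>

lemma det_one_plus_outer:
  fixes a b :: "'a::field^'n"
  shows "det (mat 1 + outer a b) = 1 + (\<Sum>i\<in>UNIV. a $ i * b $ i)"
proof -
  have "det (\<chi> i. if i \<in> K then axis i 1 + a $ i *s b else axis i 1) = 1 + (\<Sum>i\<in>K. a $ i * b $ i)"
    if "finite K" for K
    using that
  proof (induction K rule: finite_induct)
    case empty
    have "(\<chi> i. axis i 1) = (mat 1 :: 'a^'n^'n)"
      by (auto simp: vec_eq_iff mat_def axis_def)
    then show ?case by simp
  next
    case (insert j K)
    let ?c = "\<lambda>i. if i \<in> K then axis i 1 + a $ i *s b else axis i 1"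
    have "(\<chi> i. if i \<in> insert j K then axis i 1 + a $ i *s b else axis i 1)
        = (\<chi> i. if i = j then axis i 1 + a $ j *s b else ?c i)"
      using insert by (auto simp: vec_eq_iff)
    moreover have "(\<chi> i. if i = j then axis i 1 else ?c i) = (\<chi> i. ?c i)"
      using insert by (auto simp: vec_eq_iff)
    ultimately show ?case
      using insert det_replace_row_partial[of K j b a]
      by (simp add: det_row_add[of j] det_row_mul[of j])
  qed
  from this[of UNIV] have "det (\<chi> i. axis i 1 + a $ i *s b) = 1 + (\<Sum>i\<in>UNIV. a $ i * b $ i)"
    by simp
  moreover have "(\<chi> i. axis i 1 + a $ i *s b) = mat 1 + outer a b"
    by (auto simp: vec_eq_iff mat_def axis_def outer_def)
  ultimately show ?thesis by simp
qed

section \<open>Algebra of matrix products with scalar and rank-one matrices\<close>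

lemma matrix_add_rdistrib: "(A + B) ** C = A ** C + B ** (C :: 'a::semiring_1^'p^'n)"
  by (vector matrix_matrix_mult_def sum.distrib[symmetric] field_simps)

lemma matrix_diff_ldistrib: "A ** (B - C) = A ** B - A ** (C :: 'a::ring_1^'p^'n)"
  by (vector matrix_matrix_mult_def sum_subtractf[symmetric] algebra_simps)

lemma matrix_diff_rdistrib: "(A - B) ** C = A ** C - B ** (C :: 'a::ring_1^'p^'n)"
  by (vector matrix_matrix_mult_def sum_subtractf[symmetric] algebra_simps)

lemma mat_mult_left: "mat c ** A = (\<chi> i j. c * A $ i $ j)" for A :: "'a::semiring_1^'p^'n"
  by (simp add: vec_eq_iff matrix_matrix_mult_def mat_def if_distrib if_distribR cong: if_cong)

lemma mat_mult_right: "A ** mat c = (\<chi> i j. A $ i $ j * c)" for A :: "'a::semiring_1^'n^'p"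
  by (simp add: vec_eq_iff matrix_matrix_mult_def mat_def if_distrib if_distribR cong: if_cong)

lemma mat_mult_commute: "mat c ** A = A ** mat c" for A :: "'a::comm_semiring_1^'n^'m"
  by (simp add: mat_mult_left mat_mult_right mult.commute)

lemma matrix_mult_outer: "A ** outer a b = outer (A *v a) (b :: 'a::comm_semiring_1^'p)"
  by (simp add: vec_eq_iff matrix_matrix_mult_def matrix_vector_mult_def outer_def
      sum_distrib_right mult.assoc)

lemma outer_mult_matrix: "outer a b ** A = outer a (b v* (A :: 'a::comm_semiring_1^'p^'m))"
  by (simp add: vec_eq_iff matrix_matrix_mult_def vector_matrix_mult_def outer_def
      sum_distrib_left mult.assoc)

lemma outer_mult_vector: "outer a b *v x = (b \<bullet> x) *\<^sub>R (a :: real^'m)"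
  by (simp add: vec_eq_iff matrix_vector_mult_def outer_def inner_vec_def sum_distrib_left
      sum_distrib_right mult_ac)

text \<open>Adding \<open>v w^T\<close> moves the eigenvalue \<open>c\<close> to
  \<open>c + 1\<close> and keeps the others: as \<open>v\<close> is an eigenvector,
  \<open>t - M - v w^T\<close> factors as \<open>t - M\<close> times a rank-one perturbation of the
  identity. The identity is stated without division, so that it also makes sense where
  \<open>det (mat t - M)\<close> vanishes.\<close>

lemma det_deflated:
  fixes M :: "'a::field^'n^'n"
  assumes "M *v v = c *s v" "(\<Sum>i\<in>UNIV. v $ i * w $ i) = 1" "t \<noteq> c"
  shows "det (mat t - (M + outer v w)) * (t - c) = det (mat t - M) * (t - c - 1)"
proof -
  have "(mat t - M) *v v = (t - c) *s v"
  proof -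
    have "mat t *v v = t *s v"
      by (simp add: vec_eq_iff matrix_vector_mult_def mat_def if_distrib if_distribR cong: if_cong)
    moreover have "(mat t - M) *v v = mat t *v v - M *v v"
      by (simp add: vec_eq_iff matrix_vector_mult_def sum_subtractf algebra_simps)
    ultimately show ?thesis
      using assms(1) by (simp add: vec_eq_iff algebra_simps)
  qed
  \<comment> \<open>This factor is chosen so that \<open>t - M\<close> maps \<open>k *s v\<close> to
    \<open>- v\<close>, which yields the factorization.\<close>
  moreover define k where "k = - 1 / (t - c)"
  moreover have "k * (t - c) = - 1"
    using assms(3) by (simp add: k_def)
  ultimately have "(mat t - M) *v (k *s v) = (- 1) *s v"
    by (simp only: vector_scalar_commute vector_smult_assoc)
  then have "(mat t - M) *v (k *s v) = - v"
    by simp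
  then have "(mat t - M) ** outer (k *s v) w = - outer v w"
    by (simp add: matrix_mult_outer) (simp add: vec_eq_iff outer_def)
  then have "mat t - (M + outer v w) = (mat t - M) ** (mat 1 + outer (k *s v) w)"
    by (simp add: matrix_add_ldistrib)
  then have "det (mat t - (M + outer v w)) = det (mat t - M) * (1 + (\<Sum>i\<in>UNIV. k * (v $ i * w $ i)))"
    by (simp add: det_mul det_one_plus_outer mult.assoc)
  also have "(\<Sum>i\<in>UNIV. k * (v $ i * w $ i)) = - 1 / (t - c)"
    unfolding sum_distrib_left[symmetric] assms(2) by (simp add: k_def)
  finally show ?thesis using assms(3) by (simp add: field_simps)
qed

section \<open>The homogeneous Lyapunov equation\<close>

text \<open>\<open>poly_act A S p\<close> is \<open>p(A) S\<close>; the type of square matrices carries no ring structure with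
  product \<open>**\<close> in which \<open>p\<close> could be evaluated.\<close>

definition poly_act :: "'a::comm_ring_1^'n^'n \<Rightarrow> 'a^'n^'n \<Rightarrow> 'a poly \<Rightarrow> 'a^'n^'n" where
  "poly_act A S p = fold_coeffs (\<lambda>a Y. mat a ** S + A ** Y) p 0"

lemma poly_act_0 [simp]: "poly_act A S 0 = 0"
  by (simp add: poly_act_def)

lemma poly_act_pCons [simp]: "poly_act A S (pCons a p) = mat a ** S + A ** poly_act A S p"
  by (cases "p = 0 \<and> a = 0") (auto simp: poly_act_def)

lemma mat_add: "mat (a + b) = mat a + (mat b :: 'a::monoid_add^'n^'n)"
  by (simp add: vec_eq_iff mat_def)

lemma poly_act_add: "poly_act A S (p + q) = poly_act A S p + poly_act A S q"
proof (induction p q rule: poly_induct2)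
  case (pCons a p b q)
  then show ?case
    by (simp add: mat_add matrix_add_rdistrib matrix_add_ldistrib)
qed simp

lemma poly_act_monom: "poly_act A S (monom c i) = mat c ** (((**) A ^^ i) S)"
proof (induction i)
  case 0
  then show ?case by (simp add: monom_0)
next
  case (Suc i)
  have "A ** (mat c ** X) = mat c ** (A ** X)" for X
    by (metis mat_mult_commute matrix_mul_assoc)
  then show ?case using Suc by (simp add: monom_Suc)
qed

lemma poly_act_sum: "poly_act A S (\<Sum>i\<in>I. f i) = (\<Sum>i\<in>I. poly_act A S (f i))"
  by (induction I rule: infinite_finite_induct) (simp_all add: poly_act_add)

lemma poly_act_smult: "poly_act A S (smult c p) = mat c ** poly_act A S p"
proof (induction p)
  case (pCons a p)
  have "A ** (mat c ** X) = mat c ** (A ** X)" for X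
    by (metis mat_mult_commute matrix_mul_assoc)
  moreover have "mat (c * a) ** S = mat c ** (mat a ** S)"
    by (simp add: mat_mult_left mult.assoc)
  ultimately show ?case using pCons by (simp add: matrix_add_ldistrib)
qed simp

text \<open>A linear factor commutes with powers of \<open>A\<close> and can therefore be absorbed
  into \<open>S\<close>. An induction on the degree can then continue with the quotient polynomial
  and the new matrix \<open>(A - mat r) ** S\<close>.\<close>

lemma poly_act_linear_factor:
  "poly_act A S ([:- r, 1:] * p) = poly_act A ((A - mat r) ** S) p"
proof (induction p)
  case (pCons a p)
  have "[:- r, 1:] * pCons a p = smult a [:- r, 1:] + pCons 0 ([:- r, 1:] * p)"
    by (simp add: mult_pCons_right algebra_simps)
  also have "poly_act A S \<dots> = poly_act A S (smult a [:- r, 1:]) + A ** poly_act A S ([:- r, 1:] * p)"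
    by (simp only: poly_act_add poly_act_pCons mat_0 times0_left add_0)
  also have "poly_act A S (smult a [:- r, 1:]) = mat a ** ((A - mat r) ** S)"
    unfolding poly_act_smult
    by (simp add: matrix_diff_rdistrib mat_mult_left vec_eq_iff)
  finally show ?case using pCons by simp
qed simp

text \<open>The iterates \<open>S, A S, A (A S), ...\<close> lie in a finite-dimensional space, so a
  nontrivial linear relation among them exists; its coefficients form \<open>p\<close>.\<close>

lemma exists_poly_act_eq_0:
  fixes A S :: "complex^'n^'n"
  obtains p where "p \<noteq> 0" "poly_act A S p = 0"
proof -
  define f where "f i = ((**) A ^^ i) S" for i
  \<comment> \<open>This is the dimension over the reals, so the relation found below has real
    coefficients. The range \<open>{..?N}\<close> has one index more than the dimension.\<close>
  let ?N = "DIM(complex^'n^'n)"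
  show ?thesis
  proof (cases "inj_on f {..?N}")
    case True
    have "dependent (f ` {..?N})"
      by (rule dependent_biggerset) (simp add: card_image[OF True] del: DIM_cart)
    then obtain u where u: "\<exists>x\<in>f ` {..?N}. u x \<noteq> 0" "(\<Sum>x\<in>f ` {..?N}. u x *\<^sub>R x) = 0"
      by (subst (asm) dependent_finite) auto
    define p where "p = (\<Sum>i\<le>?N. monom (complex_of_real (u (f i))) i)"
    from u(1) obtain k where "k \<le> ?N" "u (f k) \<noteq> 0" by auto
    then have "coeff p k \<noteq> 0"
      by (simp add: p_def coeff_sum if_distrib cong: if_cong)
    then have "p \<noteq> 0" by auto
    moreover have "poly_act A S p = (\<Sum>i\<le>?N. u (f i) *\<^sub>R f i)"
      unfolding p_def poly_act_sum poly_act_monom f_def[symmetric] mat_mult_left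
      by (intro sum.cong refl) (simp add: vec_eq_iff, simp add: scaleR_conv_of_real)
    then have "poly_act A S p = 0"
      using u(2) unfolding sum.reindex[OF True] o_def by simp
    ultimately show ?thesis by (rule that)
  next
    \<comment> \<open>Repeated iterates shrink the image set, so counting its elements says nothing;
      two equal iterates give a relation directly.\<close>
    case False
    then obtain i j where ij: "i \<noteq> j" "f i = f j" by (auto simp: inj_on_def)
    define p where "p = monom 1 i + monom (- 1 :: complex) j"
    have "coeff p i \<noteq> 0" using ij by (simp add: p_def)
    then have "p \<noteq> 0" by auto
    moreover have "poly_act A S p = 0"
      unfolding p_def poly_act_add poly_act_monom f_def[symmetric] mat_mult_left
      using ij by (simp add: vec_eq_iff)
    ultimately show ?thesis by (rule that)
  qed
qed

lemma det_nz_mult_eq_0_iff: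
  fixes A :: "'a::field^'n^'n"
  assumes "det A \<noteq> 0"
  shows "A ** X = 0 \<longleftrightarrow> X = 0" "X ** A = 0 \<longleftrightarrow> X = 0"
proof -
  from assms obtain B where B: "B ** A = mat 1" "A ** B = mat 1"
    using invertible_det_nz[of A] by (auto simp: invertible_def)
  show "A ** X = 0 \<longleftrightarrow> X = 0"
    by (metis B(1) matrix_mul_assoc matrix_mul_lid times0_right)
  show "X ** A = 0 \<longleftrightarrow> X = 0"
    by (metis B(2) matrix_mul_assoc matrix_mul_rid times0_left)
qed

text \<open>Choose \<open>p\<close> with \<open>p(A) S = 0\<close> and split off linear factors \<open>A - r\<close>. As
  \<open>(A - r) S = - S (A\<^sup>T + r)\<close>, such a factor is cancelled on the left if \<open>Re r \<le> 0\<close> and on the right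
  otherwise.\<close>

lemma homogeneous_lyapunov_complex:
  fixes A S :: "complex^'n^'n"
  assumes "\<And>t. Re t \<le> 0 \<Longrightarrow> det (mat t - A) \<noteq> 0"
    and "A ** S + S ** transpose A = 0"
  shows "S = 0"
proof -
  obtain p where "p \<noteq> 0" "poly_act A S p = 0"
    by (rule exists_poly_act_eq_0)
  with assms(2) show ?thesis
  proof (induction "degree p" arbitrary: p S)
    case 0
    then obtain c where "p = [:c:]" by (metis degree_eq_zeroE)
    with 0 show ?case by (auto simp: mat_mult_left vec_eq_iff)
  next
    case (Suc n)
    have "\<not> constant (poly p)"
      using Suc(2) by (simp add: constant_degree)
    then obtain r where "poly p r = 0"
      using fundamental_theorem_of_algebra by blast
    then obtain q where pq: "p = [:- r, 1:] * q"
      by (auto simp: poly_eq_0_iff_dvd)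
    with Suc have q: "q \<noteq> 0" by auto
    then have dq: "degree q = n"
      using Suc(2) unfolding pq by (subst (asm) degree_mult_eq) auto
    have eq: "A ** S = - (S ** transpose A)"
      using Suc.prems by (simp add: eq_neg_iff_add_eq_0)
    let ?S = "(A - mat r) ** S"
    \<comment> \<open>Since \<open>A\<close> commutes with \<open>A - mat r\<close>, the matrix
      \<open>?S\<close> solves the same equation and the induction hypothesis applies to it.\<close>
    have "A ** ?S + ?S ** transpose A = (A - mat r) ** (A ** S + S ** transpose A)"
      using mat_mult_commute[of r A]
      by (simp add: matrix_diff_rdistrib matrix_diff_ldistrib matrix_add_ldistrib matrix_mul_assoc)
    also have "\<dots> = 0" using Suc.prems by simp
    finally have lyap: "A ** ?S + ?S ** transpose A = 0" .
    have act: "poly_act A ?S q = 0"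
      using Suc.prems(3) unfolding pq poly_act_linear_factor .
    have S0: "?S = 0"
      by (rule Suc(1)[OF dq[symmetric] lyap q act])
    show "S = 0"
    proof (cases "Re r \<le> 0")
      case True
      have "(mat r - A) ** S = 0"
        using S0 by (simp add: matrix_diff_rdistrib)
      then show ?thesis
        using det_nz_mult_eq_0_iff(1) assms(1)[OF True] by blast
    next
      case False
      then have "det (transpose (mat (- r) - A)) \<noteq> 0"
        using assms(1)[of "- r"] by (simp only: det_transpose) auto
      moreover have "S ** transpose (mat (- r) - A) = ?S"
      proof -
        have "transpose (mat (- r) - A) = mat (- r) - transpose A"
          by (simp add: vec_eq_iff transpose_def mat_def)
        then have "S ** transpose (mat (- r) - A) = S ** mat (- r) - S ** transpose A"
          by (simp only: matrix_diff_ldistrib)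
        also have "S ** mat (- r) = - (mat r ** S)"
          by (simp add: mat_mult_left mat_mult_right vec_eq_iff)
        finally show ?thesis
          by (simp add: matrix_diff_rdistrib eq)
      qed
      ultimately show ?thesis
        using det_nz_mult_eq_0_iff(2) S0 by metis
    qed
  qed
qed

section \<open>Transfer to real matrices and perturbation of the Lyapunov operator\<close>

lemma complex_matrix_add: "complex_matrix (A + B) = complex_matrix A + complex_matrix B"
  by (simp add: vec_eq_iff complex_matrix_def)

lemma complex_matrix_mult: "complex_matrix (A ** B) = complex_matrix A ** complex_matrix B"
  by (simp add: vec_eq_iff complex_matrix_def matrix_matrix_mult_def)

lemma complex_matrix_transpose: "complex_matrix (transpose A) = transpose (complex_matrix A)"
  by (simp add: vec_eq_iff complex_matrix_def transpose_def)

lemma complex_matrix_eq_0_iff: "complex_matrix A = 0 \<longleftrightarrow> A = 0"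
  by (simp add: vec_eq_iff complex_matrix_def)

text \<open>Splitting off linear factors requires complex roots; the real equation is embedded
  entrywise, and the embedding is injective.\<close>

lemma homogeneous_lyapunov:
  fixes A S :: "real^'n^'n"
  assumes "\<And>t. Re t \<le> 0 \<Longrightarrow> det (mat t - complex_matrix A) \<noteq> 0"
    and "A ** S + S ** transpose A = 0"
  shows "S = 0"
  using homogeneous_lyapunov_complex[OF assms(1), of "complex_matrix S"] assms(2)
  by (metis complex_matrix_add complex_matrix_mult complex_matrix_transpose complex_matrix_eq_0_iff)

lemma bounded_bilinear_matrix_mult:
  "bounded_bilinear ((**) :: real^'n^'m \<Rightarrow> real^'p^'n \<Rightarrow> real^'p^'m)"
  unfolding bilinear_conv_bounded_bilinear[symmetric] bilinear_def
  by (auto intro!: linearI simp: matrix_add_ldistrib matrix_add_rdistrib matrix_scalar_ac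
      scalar_matrix_assoc)

lemma bounded_linear_transpose: "bounded_linear (transpose :: real^'n^'m \<Rightarrow> real^'m^'n)"
  unfolding linear_conv_bounded_linear[symmetric]
  by (auto intro!: linearI simp: vec_eq_iff transpose_def)

text \<open>The limiting operator is injective on a finite-dimensional space, hence bounded below by
  some \<open>b\<close>. The operators of \<open>A i\<close> differ from it by a perturbation of
  norm eventually below \<open>b / 2\<close>, which leaves the constant
  \<open>b / 2\<close>.\<close>

lemma lyapunov_bounded_below:
  fixes A :: "'i \<Rightarrow> real^'n^'n"
  assumes "(A \<longlongrightarrow> A0) G" and "\<And>t. Re t \<le> 0 \<Longrightarrow> det (mat t - complex_matrix A0) \<noteq> 0"
  obtains c where "c > 0"
    "\<forall>\<^sub>F i in G. \<forall>S. c * norm S \<le> norm (A i ** S + S ** transpose (A i))"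
proof -
  interpret mm: bounded_bilinear "(**) :: real^'n^'n \<Rightarrow> real^'n^'n \<Rightarrow> real^'n^'n"
    by (rule bounded_bilinear_matrix_mult)
  let ?T = "\<lambda>A S. A ** S + S ** transpose A"
  have lin: "linear (?T A0)"
    by (auto intro!: linearI simp: mm.add_left mm.add_right mm.scaleR_left mm.scaleR_right
        scaleR_add_right)
  have inj: "inj (?T A0)"
    unfolding linear_injective_0[OF lin] using homogeneous_lyapunov[OF assms(2)] by blast
  then obtain b where b: "b > 0" "\<And>S. b * norm S \<le> norm (?T A0 S)"
    using linear_inj_bounded_below_pos[OF lin inj] by blast
  from mm.pos_bounded obtain K where
    K: "K > 0" "\<And>(X :: real^'n^'n) (Y :: real^'n^'n). norm (X ** Y) \<le> norm X * norm Y * K"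
    by auto
  have "((\<lambda>i. transpose (A i)) \<longlongrightarrow> transpose A0) G"
    using bounded_linear.tendsto[OF bounded_linear_transpose assms(1)] .
  \<comment> \<open>The limit is kept in the unsimplified form produced by the limit rules; its
    value is 0.\<close>
  then have "((\<lambda>i. norm (A i - A0) * K + norm (transpose (A i) - transpose A0) * K)
      \<longlongrightarrow> norm (A0 - A0) * K + norm (transpose A0 - transpose A0) * K) G"
    by (intro tendsto_intros assms(1))
  then have "\<forall>\<^sub>F i in G. norm (A i - A0) * K + norm (transpose (A i) - transpose A0) * K < b / 2"
    by (rule order_tendstoD) (use b in simp)
  then have "\<forall>\<^sub>F i in G. \<forall>S. b / 2 * norm S \<le> norm (?T (A i) S)"
  proof eventually_elim
    case (elim i)
    show ?case
    proof
      fix S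
      have "?T A0 S = ?T (A i) S - ((A i - A0) ** S + S ** (transpose (A i) - transpose A0))"
        by (simp add: mm.diff_left mm.diff_right)
      then have "norm (?T A0 S) \<le> norm (?T (A i) S) +
          (norm ((A i - A0) ** S) + norm (S ** (transpose (A i) - transpose A0)))"
        by (metis (no_types, lifting) add_left_mono norm_triangle_ineq norm_triangle_ineq4 order_trans)
      also have "\<dots> \<le> norm (?T (A i) S) +
          (norm (A i - A0) * norm S * K + norm S * norm (transpose (A i) - transpose A0) * K)"
        by (intro add_mono K order_refl)
      also have "\<dots> = norm (?T (A i) S) +
          (norm (A i - A0) * K + norm (transpose (A i) - transpose A0) * K) * norm S"
        by (simp add: algebra_simps)
      also have "\<dots> \<le> norm (?T (A i) S) + b / 2 * norm S"
        by (intro add_left_mono mult_right_mono) (use elim in auto)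
      finally show "b / 2 * norm S \<le> norm (?T (A i) S)"
        using b(2)[of S] by simp
    qed
  qed
  then show ?thesis using b(1) by (intro that[of "b / 2"]) auto
qed

section \<open>Gaussian tail and small-ball estimates\<close>

text \<open>Chebyshev's inequality, by Markov's inequality for the squared deviation; the point mass
  \<open>s = 0\<close> is treated apart because it has no density.\<close>

lemma normal_law_tail:
  assumes "0 \<le> s" "0 < R"
  shows "measure (normal_law m s) {y. R \<le> \<bar>y - m\<bar>} \<le> s / R\<^sup>2"
proof (cases "s = 0")
  case True
  have "measure (return borel m) {y. R \<le> \<bar>y - m\<bar>} = 0"
    using assms(2) by (subst measure_return) (auto simp: indicator_def)
  then show ?thesis using True by (simp add: normal_law_def)
next
  case False
  with assms(1) have s: "0 < sqrt s" by simp
  let ?D = "density lborel (normal_density m (sqrt s))"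
  have int: "integrable ?D (\<lambda>y. (y - m)\<^sup>2)"
    using integrable_normal_moment[OF s, of m 2] normal_density_nonneg[of m "sqrt s"]
    by (subst integrable_density) auto
  have "measure ?D {y \<in> space ?D. R\<^sup>2 \<le> (y - m)\<^sup>2} \<le> integral\<^sup>L ?D (\<lambda>y. (y - m)\<^sup>2) / R\<^sup>2"
    by (rule integral_Markov_inequality_measure[OF int, of "{}"]) (use assms in auto)
  also have "integral\<^sup>L ?D (\<lambda>y. (y - m)\<^sup>2) = (sqrt s)\<^sup>2"
    using integral_normal_moment_even[OF s, of m 1] normal_density_nonneg[of m "sqrt s"]
    by (subst integral_density) (auto simp: fact_numeral)
  also have "{y \<in> space ?D. R\<^sup>2 \<le> (y - m)\<^sup>2} = {y. R \<le> \<bar>y - m\<bar>}"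
    using assms(2) abs_le_square_iff[of R] by auto
  finally show ?thesis using False assms by (simp add: normal_law_def)
qed

text \<open>The density is at most \<open>1 / sqrt s\<close> and the interval has length
  \<open>2 * K\<close>. The bound is uniform in the shift \<open>a\<close>, which will absorb the
  contribution of the equilibrium.\<close>

lemma normal_law_small_ball:
  assumes "0 < s" "0 \<le> K"
  shows "measure (normal_law m s) {y. \<bar>a + y\<bar> \<le> K} \<le> 2 * K / sqrt s"
proof -
  let ?f = "normal_density m (sqrt s)"
  have le: "?f y \<le> 1 / sqrt s" for y
  proof -
    have "?f y \<le> 1 / sqrt (2 * pi * s)"
      using assms(1) by (simp add: normal_density_def field_simps)
    also have "\<dots> \<le> 1 / sqrt s"
      using assms(1) pi_gt3 by (intro divide_left_mono) auto
    finally show ?thesis .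
  qed
  have set: "{y. \<bar>a + y\<bar> \<le> K} = {- a - K .. - a + K}"
    by auto
  have "emeasure (density lborel ?f) {y. \<bar>a + y\<bar> \<le> K}
      = (\<integral>\<^sup>+ y. ennreal (?f y) * indicator {y. \<bar>a + y\<bar> \<le> K} y \<partial>lborel)"
    by (subst emeasure_density) (auto simp: set)
  also have "\<dots> \<le> (\<integral>\<^sup>+ y. ennreal (1 / sqrt s) * indicator {- a - K .. - a + K} y \<partial>lborel)"
    unfolding set by (intro nn_integral_mono mult_right_mono ennreal_leI le) auto
  also have "\<dots> = ennreal (1 / sqrt s) * ennreal (2 * K)"
    using assms(2) by (subst nn_integral_cmult_indicator) auto
  also have "\<dots> = ennreal (2 * K / sqrt s)"
    using assms by (simp add: ennreal_mult[symmetric])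
  finally have "measure (density lborel ?f) {y. \<bar>a + y\<bar> \<le> K} \<le> 2 * K / sqrt s"
    unfolding measure_def using assms by (intro enn2real_leI) auto
  then show ?thesis using assms by (simp add: normal_law_def)
qed

text \<open>Gaussian vectors are defined through their linear functionals, so the events accessible
  directly are those involving a single functional. The alignment estimate below is assembled from
  such events.\<close>

lemma gaussian_vector_measure:
  assumes "gaussian_vector \<Omega> X m S" "{y. P y} \<in> sets borel"
  shows "measure \<Omega> {\<omega> \<in> space \<Omega>. P (u \<bullet> X \<omega>)} = measure (normal_law (u \<bullet> m) (u \<bullet> (S *v u))) {y. P y}"
proof -
  have [measurable]: "X \<in> borel_measurable \<Omega>"
    using assms(1) by (simp add: gaussian_vector_def)
  have "measure (distr \<Omega> borel (\<lambda>\<omega>. u \<bullet> X \<omega>)) {y. P y} = measure \<Omega> ((\<lambda>\<omega>. u \<bullet> X \<omega>) -` {y. P y} \<inter> space \<Omega>)"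
    by (rule measure_distr) (use assms(2) in measurable)
  also have "(\<lambda>\<omega>. u \<bullet> X \<omega>) -` {y. P y} \<inter> space \<Omega> = {\<omega> \<in> space \<Omega>. P (u \<bullet> X \<omega>)}"
    by auto
  finally show ?thesis using assms(1) by (simp add: gaussian_vector_def)
qed

lemma gaussian_vector_tail:
  assumes "gaussian_vector \<Omega> X 0 S" "0 < R"
  shows "measure \<Omega> {\<omega> \<in> space \<Omega>. R \<le> \<bar>u \<bullet> X \<omega>\<bar>} \<le> u \<bullet> (S *v u) / R\<^sup>2"
  using normal_law_tail[of "u \<bullet> (S *v u)" R 0] assms
  by (subst gaussian_vector_measure[OF assms(1)]) (auto simp: gaussian_vector_def)

lemma gaussian_vector_small_ball:
  assumes "gaussian_vector \<Omega> X 0 S" "0 < u \<bullet> (S *v u)" "0 \<le> K"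
  shows "measure \<Omega> {\<omega> \<in> space \<Omega>. \<bar>a + u \<bullet> X \<omega>\<bar> \<le> K} \<le> 2 * K / sqrt (u \<bullet> (S *v u))"
  using normal_law_small_ball[OF assms(2,3)]
  by (subst gaussian_vector_measure[OF assms(1)]) auto

section \<open>Scale invariance and continuity of the spatial statistics\<close>

lemma spatial_mean_scaleR: "spatial_mean (c *\<^sub>R u) = c * spatial_mean u"
  by (simp add: spatial_mean_def sum_distrib_left)

lemma spatial_moment_scaleR: "spatial_moment k (c *\<^sub>R u) = c ^ k * spatial_moment k u"
  by (simp add: spatial_moment_def spatial_mean_scaleR power_mult_distrib sum_distrib_left
      flip: right_diff_distrib)

lemma spatial_moment_2_nonneg: "0 \<le> spatial_moment 2 u"
  by (simp add: spatial_moment_def sum_nonneg)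

lemma spatial_skewness_scaleR:
  assumes "c \<noteq> 0"
  shows "spatial_skewness (c *\<^sub>R u) = sgn c * spatial_skewness u"
proof -
  \<comment> \<open>The denominator scales by \<open>\<bar>c\<bar> ^ 3\<close> and the third moment
    by \<open>c ^ 3\<close>, so exactly the sign of \<open>c\<close> survives.\<close>
  have "c\<^sup>2 = \<bar>c\<bar> powr 2"
    using assms by simp
  then have "(c\<^sup>2) powr (3/2) = \<bar>c\<bar> powr (2 * (3/2))"
    by (simp only: powr_powr)
  also have "\<dots> = \<bar>c\<bar> ^ 3"
    using assms powr_realpow[of "\<bar>c\<bar>" 3] by simp
  finally have "spatial_skewness (c *\<^sub>R u) = (c / \<bar>c\<bar>) ^ 3 * spatial_skewness u"
    by (simp add: spatial_skewness_def spatial_moment_scaleR powr_mult spatial_moment_2_nonneg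
        power_divide)
  also have "(c / \<bar>c\<bar>) ^ 3 = sgn c"
    using assms by (cases "c > 0") (auto simp: sgn_if)
  finally show ?thesis .
qed

lemma spatial_kurtosis_scaleR:
  assumes "c \<noteq> 0"
  shows "spatial_kurtosis (c *\<^sub>R u) = spatial_kurtosis u"
  using assms by (simp add: spatial_kurtosis_def spatial_moment_scaleR power_mult_distrib)

lemma moran_I_scaleR:
  assumes "c \<noteq> 0"
  shows "moran_I A (c *\<^sub>R u) = moran_I A u"
proof -
  let ?s = "\<lambda>u. \<Sum>i\<in>UNIV. \<Sum>j\<in>UNIV. A $ i $ j * (u $ i - spatial_mean u) * (u $ j - spatial_mean u)"
  have "?s (c *\<^sub>R u) = c\<^sup>2 * ?s u"
    by (simp add: spatial_mean_scaleR sum_distrib_left power2_eq_square algebra_simps)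
  moreover have "(\<Sum>i\<in>UNIV. ((c *\<^sub>R u) $ i - spatial_mean (c *\<^sub>R u))\<^sup>2)
      = c\<^sup>2 * (\<Sum>i\<in>UNIV. (u $ i - spatial_mean u)\<^sup>2)"
    by (simp add: spatial_mean_scaleR sum_distrib_left power_mult_distrib flip: right_diff_distrib)
  ultimately show ?thesis using assms by (simp add: moran_I_def)
qed

lemma continuous_spatial_mean: "continuous_on UNIV (spatial_mean :: real^'n \<Rightarrow> real)"
  unfolding spatial_mean_def by (intro continuous_intros) auto

lemma continuous_spatial_moment: "continuous_on UNIV (spatial_moment k :: real^'n \<Rightarrow> real)"
  unfolding spatial_moment_def
  by (intro continuous_intros continuous_on_subset[OF continuous_spatial_mean]) auto

lemma isCont_spatial_skewness:
  "0 < spatial_moment 2 u \<Longrightarrow> isCont spatial_skewness (u :: real^'n)"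
  unfolding spatial_skewness_def using continuous_spatial_moment
  by (intro continuous_intros) (auto simp: continuous_on_eq_continuous_at)

lemma isCont_spatial_kurtosis:
  "0 < spatial_moment 2 u \<Longrightarrow> isCont spatial_kurtosis (u :: real^'n)"
  unfolding spatial_kurtosis_def using continuous_spatial_moment
  by (intro continuous_intros) (auto simp: continuous_on_eq_continuous_at)

lemma isCont_moran_I:
  assumes "0 < spatial_moment 2 u"
  shows "isCont (moran_I A) (u :: real^'n)"
proof -
  \<comment> \<open>The denominator of Moran's statistic is the number of sites times the second
    spatial moment.\<close>
  have "(\<Sum>i\<in>UNIV. (u $ i - spatial_mean u)\<^sup>2) \<noteq> 0"
    using assms by (auto simp: spatial_moment_def)
  moreover have "isCont spatial_mean u"
    using continuous_spatial_mean by (auto simp: continuous_on_eq_continuous_at)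
  ultimately show ?thesis
    unfolding moran_I_def by (intro continuous_intros) auto
qed

section \<open>Borel measurability of the statistics\<close>

lemma borel_measurable_spatial_mean [measurable]:
  "(spatial_mean :: real^'n \<Rightarrow> real) \<in> borel_measurable borel"
  using borel_measurable_continuous_onI[OF continuous_spatial_mean] .

lemma borel_measurable_spatial_moment [measurable]:
  "(spatial_moment k :: real^'n \<Rightarrow> real) \<in> borel_measurable borel"
  using borel_measurable_continuous_onI[OF continuous_spatial_moment] .

lemma borel_measurable_spatial_skewness: "(spatial_skewness :: real^'n \<Rightarrow> real) \<in> borel_measurable borel"
  unfolding spatial_skewness_def by measurable

lemma borel_measurable_spatial_kurtosis: "(spatial_kurtosis :: real^'n \<Rightarrow> real) \<in> borel_measurable borel"
  unfolding spatial_kurtosis_def by measurable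

lemma borel_measurable_moran_I: "(moran_I A :: real^'n \<Rightarrow> real) \<in> borel_measurable borel"
proof -
  have [measurable]: "(\<lambda>u :: real^'n. u $ i) \<in> borel_measurable borel" for i
    by (intro borel_measurable_continuous_onI continuous_intros)
  show ?thesis unfolding moran_I_def by measurable
qed

text \<open>For a unit vector this turns the condition on \<open>\<rho>_c\<close> into positivity of
  the spatial variance, the condition under which the statistics are continuous.\<close>

lemma spatial_moment_2_unit_vector:
  fixes u :: "real^'n"
  assumes "norm u = 1"
  shows "spatial_moment 2 u = (1 - (1 \<bullet> u)\<^sup>2 / real CARD('n)) / real CARD('n)"
proof -
  let ?N = "real CARD('n)"
  have s: "(\<Sum>i\<in>UNIV. u $ i) = 1 \<bullet> u"
    by (simp add: inner_vec_def)
  have "(\<Sum>i\<in>UNIV. (u $ i - spatial_mean u)\<^sup>2)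
      = (\<Sum>i\<in>UNIV. (u $ i)\<^sup>2) - 2 * spatial_mean u * (\<Sum>i\<in>UNIV. u $ i) + ?N * (spatial_mean u)\<^sup>2"
    by (simp add: power2_diff sum.distrib sum_subtractf sum_distrib_left algebra_simps)
  also have "(\<Sum>i\<in>UNIV. (u $ i)\<^sup>2) = 1"
    using assms by (simp add: norm_eq_1 inner_vec_def power2_eq_square)
  finally show ?thesis
    unfolding spatial_moment_def spatial_mean_def s
    by (simp add: field_simps power2_eq_square)
qed

lemma centering_matrix_mult:
  "centering_matrix *v u = (\<chi> i. u $ i - spatial_mean u)" for u :: "real^'n"
proof -
  have "((\<chi> i j. 1) :: real^'n^'n) *v u = (\<chi> i. real CARD('n) * spatial_mean u)"
    by (simp add: vec_eq_iff matrix_vector_mult_def spatial_mean_def)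
  then show ?thesis
    by (simp add: centering_matrix_def matrix_vector_mult_diff_rdistrib
        scaleR_matrix_vector_assoc[symmetric] vec_eq_iff)
qed

text \<open>The centering matrix is symmetric and idempotent, so both quadratic forms can be
  evaluated on the centered vector.\<close>

lemma moran_I_centering_matrix:
  fixes u :: "real^'n"
  shows "moran_I A u = real CARD('n) / total_weight A *
    ((u \<bullet> ((centering_matrix ** A ** centering_matrix) *v u)) / (u \<bullet> (centering_matrix *v u)))"
proof -
  let ?P = "centering_matrix :: real^'n^'n"
  have sym: "a \<bullet> (?P *v b) = (?P *v a) \<bullet> b" for a b
  proof -
    have "transpose ?P = ?P"
      by (simp add: vec_eq_iff transpose_def centering_matrix_def mat_def)
    then show ?thesis
      by (metis dot_lmul_matrix vector_transpose_matrix)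
  qed
  have idem: "?P *v (?P *v u) = ?P *v u"
  proof -
    have "spatial_mean (?P *v u) = 0"
      by (simp add: centering_matrix_mult spatial_mean_def sum_subtractf)
    then show ?thesis
      by (subst centering_matrix_mult) simp
  qed
  have "u \<bullet> (?P *v u) = (?P *v u) \<bullet> (?P *v u)"
    using sym[of u "?P *v u"] by (simp add: idem)
  also have "\<dots> = (\<Sum>i\<in>UNIV. (u $ i - spatial_mean u)\<^sup>2)"
    by (simp add: centering_matrix_mult inner_vec_def power2_eq_square)
  finally have den: "u \<bullet> (?P *v u) = (\<Sum>i\<in>UNIV. (u $ i - spatial_mean u)\<^sup>2)" .
  have "u \<bullet> ((?P ** A ** ?P) *v u) = (?P *v u) \<bullet> (A *v (?P *v u))"
    by (simp add: matrix_vector_mul_assoc[symmetric] sym)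
  also have "\<dots> = (\<Sum>i\<in>UNIV. \<Sum>j\<in>UNIV. A $ i $ j * (u $ i - spatial_mean u) * (u $ j - spatial_mean u))"
    unfolding centering_matrix_mult
    by (simp add: inner_vec_def matrix_vector_mult_def sum_distrib_left mult_ac)
  finally show ?thesis unfolding moran_I_def den by simp
qed

section \<open>Continuous mapping\<close>

text \<open>The variable \<open>X i\<close> need be controlled by \<open>f (Y i)\<close> only on the
  event \<open>E i\<close>, later \<open>\<gamma> \<noteq> 0\<close>. Requiring an inequality of
  deviations, rather than \<open>X i = f (Y i)\<close>, accommodates the random sign in the
  skewness.\<close>

lemma tendsto_in_probability_continuous_mapping:
  fixes Y :: "'i \<Rightarrow> 'w \<Rightarrow> 'b::real_normed_vector" and f :: "'b \<Rightarrow> real"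
  assumes meas: "\<forall>\<^sub>F i in G. X i \<in> borel_measurable (\<Omega> i)"
    and Y: "\<And>\<epsilon>. \<epsilon> > 0 \<Longrightarrow> ((\<lambda>i. measure (\<Omega> i) {\<omega> \<in> space (\<Omega> i). \<not> (E i \<omega> \<and> dist (Y i \<omega>) c < \<epsilon>)}) \<longlongrightarrow> 0) G"
    and Y_sets: "\<And>\<epsilon>. \<forall>\<^sub>F i in G. {\<omega> \<in> space (\<Omega> i). \<not> (E i \<omega> \<and> dist (Y i \<omega>) c < \<epsilon>)} \<in> sets (\<Omega> i)"
    and finite: "\<forall>\<^sub>F i in G. prob_space (\<Omega> i)"
    and cont: "isCont f c"
    and le: "\<And>i \<omega>. E i \<omega> \<Longrightarrow> \<bar>X i \<omega> - d\<bar> \<le> \<bar>f (Y i \<omega>) - f c\<bar>"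
  shows "tendsto_in_probability \<Omega> X d G"
  unfolding tendsto_in_probability_def
proof (intro conjI meas allI impI)
  fix \<epsilon> :: real
  assume "\<epsilon> > 0"
  with cont obtain \<eta> where \<eta>: "\<eta> > 0" "\<And>y. dist y c < \<eta> \<Longrightarrow> dist (f y) (f c) < \<epsilon>"
    by (auto simp: continuous_at_eps_delta dist_commute)
  show "((\<lambda>i. measure (\<Omega> i) {\<omega> \<in> space (\<Omega> i). \<epsilon> < \<bar>X i \<omega> - d\<bar>}) \<longlongrightarrow> 0) G"
  proof (rule tendsto_sandwich[OF _ _ tendsto_const Y[OF \<eta>(1)]])
    show "\<forall>\<^sub>F i in G. measure (\<Omega> i) {\<omega> \<in> space (\<Omega> i). \<epsilon> < \<bar>X i \<omega> - d\<bar>}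
        \<le> measure (\<Omega> i) {\<omega> \<in> space (\<Omega> i). \<not> (E i \<omega> \<and> dist (Y i \<omega>) c < \<eta>)}"
      using Y_sets[of \<eta>] finite
    proof eventually_elim
      case (elim i)
      then interpret prob_space "\<Omega> i" by simp
      have "\<not> (E i \<omega> \<and> dist (Y i \<omega>) c < \<eta>)" if "\<epsilon> < \<bar>X i \<omega> - d\<bar>" for \<omega>
        using le[of i \<omega>] \<eta>(2)[of "Y i \<omega>"] that by (auto simp: dist_real_def)
      then show ?case
        by (intro finite_measure_mono elim) auto
    qed
  qed simp
qed

section \<open>The deflated stability matrix\<close>

lemma tendsto_det:
  fixes A :: "'i \<Rightarrow> complex^'n^'n"
  assumes "(A \<longlongrightarrow> A0) G"
  shows "((\<lambda>i. det (A i)) \<longlongrightarrow> det A0) G"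
  unfolding det_def by (intro tendsto_intros tendsto_vec_nth assms)

lemma tendsto_complex_matrix:
  assumes "(A \<longlongrightarrow> A0) G"
  shows "((\<lambda>i. complex_matrix (A i)) \<longlongrightarrow> complex_matrix A0) G"
  unfolding complex_matrix_def
  by (intro vec_tendstoI) (simp, intro tendsto_intros tendsto_vec_nth assms)

lemma tendsto_outer:
  fixes v :: "'i \<Rightarrow> real^'m" and w :: "'i \<Rightarrow> real^'n"
  assumes "(v \<longlongrightarrow> v0) G" "(w \<longlongrightarrow> w0) G"
  shows "((\<lambda>i. outer (v i) (w i)) \<longlongrightarrow> outer v0 w0) G"
  unfolding outer_def
  by (intro vec_tendstoI) (simp, intro tendsto_intros tendsto_vec_nth assms)

text \<open>Deflation moves the critical eigenvalue from \<open>c\<close> to \<open>c + 1\<close>, so all eigenvalues stay away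
  from the closed left half-plane.\<close>

lemma norm_det_deflated_ge:
  fixes M :: "real^'n^'n"
  assumes family: "eigenvalue_family (complex_matrix M) l"
    and crit: "l k1 = complex_of_real c" "0 < c"
    and gap: "0 < \<delta>" "\<forall>k. k \<noteq> k1 \<longrightarrow> \<delta> \<le> Re (l k)"
    and eigvec: "M *v v = c *\<^sub>R v" "w \<bullet> v = 1"
    and t: "Re t \<le> 0"
  shows "\<delta> ^ (CARD('n) - 1) \<le> norm (det (mat t - complex_matrix (M + outer v w)))"
proof -
  define cv cw where "cv = (\<chi> i. complex_of_real (v $ i))" and "cw = (\<chi> i. complex_of_real (w $ i))"
  let ?c = "complex_of_real c"
  have "complex_matrix M *v cv = (\<chi> i. complex_of_real ((M *v v) $ i))"
    by (simp add: vec_eq_iff complex_matrix_def matrix_vector_mult_def cv_def)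
  then have 1: "complex_matrix M *v cv = ?c *s cv"
    by (simp add: eigvec(1) vec_eq_iff cv_def)
  have "(\<Sum>i\<in>UNIV. cv $ i * cw $ i) = complex_of_real (w \<bullet> v)"
    by (simp add: inner_vec_def cv_def cw_def mult.commute)
  with eigvec(2) have 2: "(\<Sum>i\<in>UNIV. cv $ i * cw $ i) = 1"
    by simp
  from t crit(2) have 3: "t \<noteq> ?c" by auto
  have "complex_matrix (M + outer v w) = complex_matrix M + outer cv cw"
    by (simp add: vec_eq_iff complex_matrix_def outer_def cv_def cw_def)
  then have "det (mat t - complex_matrix (M + outer v w)) * (t - ?c)
      = det (mat t - complex_matrix M) * (t - ?c - 1)"
    using det_deflated[OF 1 2 3] by simp
  also have "det (mat t - complex_matrix M) = (\<Prod>k\<in>UNIV. t - l k)"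
    using family by (simp add: eigenvalue_family_def)
  also have "\<dots> = (t - ?c) * (\<Prod>k\<in>UNIV - {k1}. t - l k)"
    by (subst prod.remove[of _ k1]) (auto simp: crit(1))
  finally have det: "det (mat t - complex_matrix (M + outer v w))
      = (t - ?c - 1) * (\<Prod>k\<in>UNIV - {k1}. t - l k)"
    using 3 by simp
  \<comment> \<open>The bound must not depend on \<open>c\<close>, which tends to 0 in the
    application. The shifted factor has real part below -1, and each of the other factors has real
    part at most \<open>- \<delta>\<close>.\<close>
  have "1 \<le> norm (t - ?c - 1)"
    using abs_Re_le_cmod[of "t - ?c - 1"] t crit(2) by simp
  moreover have "\<delta> ^ (CARD('n) - 1) \<le> norm (\<Prod>k\<in>UNIV - {k1}. t - l k)"
  proof -
    have "(\<Prod>k\<in>UNIV - {k1}. \<delta>) \<le> (\<Prod>k\<in>UNIV - {k1}. norm (t - l k))"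
    proof (intro prod_mono conjI)
      fix k assume "k \<in> UNIV - {k1}"
      then have "\<delta> \<le> Re (l k)" using gap(2) by simp
      then show "\<delta> \<le> norm (t - l k)"
        using abs_Re_le_cmod[of "t - l k"] t by simp
    qed (use gap(1) in auto)
    then show ?thesis by (simp add: prod_norm card_Diff_singleton)
  qed
  ultimately have "1 * \<delta> ^ (CARD('n) - 1)
      \<le> norm (t - ?c - 1) * norm (\<Prod>k\<in>UNIV - {k1}. t - l k)"
    using gap(1) by (intro mult_mono) auto
  then show ?thesis by (simp add: det norm_mult)
qed

text \<open>The rank-one matrix \<open>v w^T\<close> is a projection commuting with
  \<open>M\<close>, and \<open>Q\<close> is the complementary projection. Hence
  \<open>M' Q = Q M\<close>, and multiplying the Lyapunov equation by \<open>Q\<close> and its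
  transpose gives the claim.\<close>

lemma deflated_lyapunov:
  fixes M C D :: "real^'n^'n"
  assumes lyap: "M ** C + C ** transpose M = D"
    and v: "M *v v = c *\<^sub>R v" and w: "w v* M = c *\<^sub>R w" and wv: "w \<bullet> v = 1"
  defines "Q \<equiv> mat 1 - outer v w" and "M' \<equiv> M + outer v w"
  shows "M' ** (Q ** C ** transpose Q) + (Q ** C ** transpose Q) ** transpose M' = Q ** D ** transpose Q"
proof -
  have "outer v w ** outer v w = outer v w"
    by (simp add: matrix_mult_outer outer_mult_vector wv)
  moreover have "M ** outer v w = outer v w ** M"
    by (simp add: matrix_mult_outer outer_mult_matrix v w) (simp add: vec_eq_iff outer_def)
  ultimately have MQ: "M' ** Q = Q ** M"
    by (simp add: Q_def M'_def matrix_add_rdistrib matrix_diff_ldistrib matrix_diff_rdistrib)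
  then have "transpose Q ** transpose M' = transpose M ** transpose Q"
    by (metis matrix_transpose_mul)
  then have "(Q ** C ** transpose Q) ** transpose M' = Q ** (C ** transpose M) ** transpose Q"
    by (metis matrix_mul_assoc)
  moreover have "M' ** (Q ** C ** transpose Q) = Q ** (M ** C) ** transpose Q"
    by (metis MQ matrix_mul_assoc)
  ultimately show ?thesis
    by (simp add: lyap[symmetric] matrix_add_ldistrib matrix_add_rdistrib)
qed

text \<open>Testing the equation with \<open>w\<close> on both sides makes each of the two terms on
  the left equal to \<open>c * (w \<bullet> (C *v w))\<close>.\<close>

lemma lyapunov_left_eigenvector:
  fixes M C D :: "real^'n^'n"
  assumes lyap: "M ** C + C ** transpose M = D" and w: "w v* M = c *\<^sub>R w"
  shows "2 * c * (w \<bullet> (C *v w)) = w \<bullet> (D *v w)"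
proof -
  have "w \<bullet> ((M ** C) *v w) = (w v* M) \<bullet> (C *v w)"
    by (simp add: dot_lmul_matrix matrix_vector_mul_assoc)
  moreover have "(C ** transpose M) *v w = C *v (w v* M)"
    by (simp add: matrix_vector_mul_assoc[symmetric])
  ultimately show ?thesis
    by (simp add: lyap[symmetric] matrix_vector_mult_add_rdistrib inner_add_right w
        matrix_vector_mult_scaleR)
qed

text \<open>The projected covariance solves a Lyapunov equation whose operator is eventually bounded
  below and whose right-hand side converges.\<close>

lemma deflated_covariance_bounded:
  fixes M C :: "'i \<Rightarrow> real^'n^'n" and D :: "real^'n^'n" and k1 :: 'n
  assumes G: "G \<noteq> bot" and M: "(M \<longlongrightarrow> M0) G" and v: "(v \<longlongrightarrow> v0) G" and w: "(w \<longlongrightarrow> w0) G"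
    and gap_pos: "0 < \<delta>"
    and ev: "\<forall>\<^sub>F i in G. M i ** C i + C i ** transpose (M i) = D"
      "\<forall>\<^sub>F i in G. eigenvalue_family (complex_matrix (M i)) (l i)"
      "\<forall>\<^sub>F i in G. l i k1 = complex_of_real (c i)" "\<forall>\<^sub>F i in G. 0 < c i"
      "\<forall>\<^sub>F i in G. \<forall>k. k \<noteq> k1 \<longrightarrow> \<delta> \<le> Re (l i k)"
      "\<forall>\<^sub>F i in G. M i *v v i = c i *\<^sub>R v i" "\<forall>\<^sub>F i in G. w i v* M i = c i *\<^sub>R w i"
      "\<forall>\<^sub>F i in G. w i \<bullet> v i = 1"
  obtains S where "0 < S" "\<forall>\<^sub>F i in G.
    norm ((mat 1 - outer (v i) (w i)) ** C i ** transpose (mat 1 - outer (v i) (w i))) \<le> S"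
proof -
  define M' where "M' = (\<lambda>i. M i + outer (v i) (w i))"
  define Q where "Q = (\<lambda>i. mat 1 - outer (v i) (w i))"
  define Q0 where "Q0 = mat 1 - outer v0 w0"
  have M': "(M' \<longlongrightarrow> M0 + outer v0 w0) G"
    unfolding M'_def by (intro tendsto_intros M tendsto_outer v w)
  have Q: "(Q \<longlongrightarrow> Q0) G"
    unfolding Q_def Q0_def by (intro tendsto_intros tendsto_outer v w)
  \<comment> \<open>A lower bound on the determinants that is uniform along the filter passes to the
    limit, so no information about the eigenvalues of \<open>M0\<close> itself is required.\<close>
  have "det (mat t - complex_matrix (M0 + outer v0 w0)) \<noteq> 0" if t: "Re t \<le> 0" for t
  proof -
    have "((\<lambda>i. norm (det (mat t - complex_matrix (M' i))))
        \<longlongrightarrow> norm (det (mat t - complex_matrix (M0 + outer v0 w0)))) G"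
      by (intro tendsto_intros tendsto_det tendsto_complex_matrix M')
    moreover have "\<forall>\<^sub>F i in G. \<delta> ^ (CARD('n) - 1) \<le> norm (det (mat t - complex_matrix (M' i)))"
      using ev(2-6,8) unfolding M'_def
      by eventually_elim (rule norm_det_deflated_ge[OF _ _ _ gap_pos _ _ _ t])
    ultimately have "\<delta> ^ (CARD('n) - 1) \<le> norm (det (mat t - complex_matrix (M0 + outer v0 w0)))"
      using G by (intro tendsto_lowerbound)
    moreover have "0 < \<delta> ^ (CARD('n) - 1)" using gap_pos by simp
    ultimately show ?thesis by auto
  qed
  then obtain b where b: "0 < b"
    "\<forall>\<^sub>F i in G. \<forall>S. b * norm S \<le> norm (M' i ** S + S ** transpose (M' i))"
    using lyapunov_bounded_below[OF M'] by blast
  have "((\<lambda>i. norm (Q i ** D ** transpose (Q i))) \<longlongrightarrow> norm (Q0 ** D ** transpose Q0)) G"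
    by (intro tendsto_norm bounded_bilinear.tendsto[OF bounded_bilinear_matrix_mult]
        bounded_linear.tendsto[OF bounded_linear_transpose] Q tendsto_const)
  then have "\<forall>\<^sub>F i in G. norm (Q i ** D ** transpose (Q i)) < norm (Q0 ** D ** transpose Q0) + 1"
    by (rule order_tendstoD) simp
  with b(2) ev(1,6-8) have "\<forall>\<^sub>F i in G. norm (Q i ** C i ** transpose (Q i))
      \<le> (norm (Q0 ** D ** transpose Q0) + 1) / b"
  proof eventually_elim
    case (elim i)
    from elim(1) have "b * norm (Q i ** C i ** transpose (Q i))
        \<le> norm (M' i ** (Q i ** C i ** transpose (Q i)) + (Q i ** C i ** transpose (Q i)) ** transpose (M' i))"
      by blast
    also have "\<dots> = norm (Q i ** D ** transpose (Q i))"
      unfolding M'_def Q_def by (subst deflated_lyapunov[OF elim(2-5)]) simp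
    finally show ?case
      using elim(6) b(1) by (simp add: field_simps)
  qed
  then show ?thesis
    using b(1) unfolding Q_def by (intro that) (auto intro!: divide_pos_pos add_nonneg_pos)
qed

text \<open>The joint derivative in state and parameter is itself differentiable, hence continuous
  at the endpoint of the branch. The Jacobian in the state is its restriction to directions
  \<open>(h, 0)\<close>.\<close>

lemma jacobian_convergent:
  fixes F :: "real^'n \<Rightarrow> real \<Rightarrow> real^'n"
  assumes "C2_on U (\<lambda>(y, \<alpha>). F y \<alpha>)" "(xc, \<alpha>c) \<in> U" "(xs \<longlongrightarrow> xc) (at_left \<alpha>c)"
  obtains J where "((\<lambda>\<alpha>. jacobian (\<lambda>x. F x \<alpha>) (at (xs \<alpha>))) \<longlongrightarrow> J) (at_left \<alpha>c)"
proof -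
  from assms(1) obtain f' :: "(real^'n) \<times> real \<Rightarrow> ((real^'n) \<times> real) \<Rightarrow>\<^sub>L (real^'n)"
    and f'' :: "(real^'n) \<times> real \<Rightarrow> ((real^'n) \<times> real) \<Rightarrow>\<^sub>L ((real^'n) \<times> real) \<Rightarrow>\<^sub>L (real^'n)"
    where U: "open U"
    and f': "\<And>p. p \<in> U \<Longrightarrow> ((\<lambda>(y, \<alpha>). F y \<alpha>) has_derivative blinfun_apply (f' p)) (at p)"
    and f'': "\<And>p. p \<in> U \<Longrightarrow> (f' has_derivative blinfun_apply (f'' p)) (at p)"
    unfolding C2_on_def by blast
  have lim: "((\<lambda>\<alpha>. (xs \<alpha>, \<alpha>)) \<longlongrightarrow> (xc, \<alpha>c)) (at_left \<alpha>c)"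
    by (intro tendsto_intros assms(3))
  have "isCont f' (xc, \<alpha>c)"
    using f''[OF assms(2)] by (rule has_derivative_continuous)
  from isCont_tendsto_compose[OF this lim]
  have f'_lim: "((\<lambda>\<alpha>. f' (xs \<alpha>, \<alpha>)) \<longlongrightarrow> f' (xc, \<alpha>c)) (at_left \<alpha>c)" .
  have "\<forall>\<^sub>F \<alpha> in at_left \<alpha>c. (xs \<alpha>, \<alpha>) \<in> U"
    using topological_tendstoD[OF lim U assms(2)] .
  then have "\<forall>\<^sub>F \<alpha> in at_left \<alpha>c. matrix (\<lambda>h. f' (xs \<alpha>, \<alpha>) (h, 0)) = jacobian (\<lambda>x. F x \<alpha>) (at (xs \<alpha>))"
  proof eventually_elim
    case (elim \<alpha>)
    have "((\<lambda>x. (x, \<alpha>)) has_derivative (\<lambda>h. (h, 0))) (at (xs \<alpha>))"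
      by (auto intro!: derivative_eq_intros)
    from has_derivative_compose[OF this f'[OF elim]]
    have "((\<lambda>x. F x \<alpha>) has_derivative (\<lambda>h. f' (xs \<alpha>, \<alpha>) (h, 0))) (at (xs \<alpha>))"
      by simp
    then show ?case
      unfolding jacobian_def by (metis frechet_derivative_at)
  qed
  moreover have "((\<lambda>\<alpha>. matrix (\<lambda>h. f' (xs \<alpha>, \<alpha>) (h, 0))) \<longlongrightarrow> matrix (\<lambda>h. f' (xc, \<alpha>c) (h, 0))) (at_left \<alpha>c)"
    unfolding matrix_def
    by (intro vec_tendstoI) (simp, intro tendsto_vec_nth blinfun.tendsto f'_lim tendsto_const)
  ultimately show ?thesis
    by (intro that) (rule Lim_transform_eventually)
qed

section \<open>Alignment with the critical direction\<close>

text \<open>With \<open>g = w \<bullet> x\<close> one has \<open>x = g v + Q x\<close>. Alignment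
  can fail only if \<open>g\<close> falls into a fixed bounded interval, which is unlikely since its
  variance diverges, or if some coordinate of \<open>Q z\<close> is large, which is unlikely since
  its variance is at most \<open>S\<close>.\<close>

lemma gaussian_alignment:
  fixes a v w :: "'i \<Rightarrow> real^'n" and C :: "'i \<Rightarrow> real^'n^'n" and z :: "'i \<Rightarrow> 'w \<Rightarrow> real^'n"
  assumes prob: "\<forall>\<^sub>F i in G. prob_space (\<Omega> i)"
    and gauss: "\<forall>\<^sub>F i in G. gaussian_vector (\<Omega> i) (z i) 0 (C i)"
    and a: "(a \<longlongrightarrow> a0) G" and v: "(v \<longlongrightarrow> v0) G" and w: "(w \<longlongrightarrow> w0) G"
    and var: "filterlim (\<lambda>i. w i \<bullet> (C i *v w i)) at_top G"
    and S: "0 < S" "\<forall>\<^sub>F i in G.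
      norm ((mat 1 - outer (v i) (w i)) ** C i ** transpose (mat 1 - outer (v i) (w i))) \<le> S"
    and eps: "0 < \<epsilon>"
  defines "x \<equiv> \<lambda>i \<omega>. a i + z i \<omega>"
  shows "((\<lambda>i. measure (\<Omega> i) {\<omega> \<in> space (\<Omega> i). \<not> (w i \<bullet> x i \<omega> \<noteq> 0 \<and>
      dist (inverse (w i \<bullet> x i \<omega>) *\<^sub>R x i \<omega>) v0 < \<epsilon>)}) \<longlongrightarrow> 0) G"
proof (rule tendstoI)
  fix e :: real assume e: "0 < e"
  let ?N = "real CARD('n)"
  define Q where "Q = (\<lambda>i. mat 1 - outer (v i) (w i))"
  \<comment> \<open>Chosen so that the tail bounds \<open>S / R\<^sup>2\<close> of all coordinates
    sum to less than \<open>e / 2\<close>; the summand 1 makes the inequality strict and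
    \<open>R\<close> positive.\<close>
  define R where "R = sqrt (2 * ?N * S / e) + 1"
  have q: "0 \<le> 2 * ?N * S / e" using S(1) e by simp
  then have R: "0 < R"
    unfolding R_def by (intro add_nonneg_pos) auto
  have "2 * ?N * S / e = (sqrt (2 * ?N * S / e))\<^sup>2"
    using q by (simp only: real_sqrt_pow2)
  also have "\<dots> < R\<^sup>2"
    unfolding R_def using q by (intro power_strict_mono) auto
  finally have R2: "2 * ?N * S / e < R\<^sup>2" .
  have Rsmall: "?N * (S / R\<^sup>2) < e / 2"
    using R R2 e by (simp add: field_simps)
  \<comment> \<open>Eventual bound for the deterministic part \<open>Q a\<close> of the
    remainder.\<close>
  define b where "b = norm (a0 - (w0 \<bullet> a0) *\<^sub>R v0) + 1"
  have "((\<lambda>i. norm (a i - (w i \<bullet> a i) *\<^sub>R v i)) \<longlongrightarrow> norm (a0 - (w0 \<bullet> a0) *\<^sub>R v0)) G"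
    by (intro tendsto_intros a v w)
  then have ev_b: "\<forall>\<^sub>F i in G. norm (a i - (w i \<bullet> a i) *\<^sub>R v i) < b"
    by (rule order_tendstoD) (simp add: b_def)
  \<comment> \<open>The remainder will be smaller than \<open>b + ?N * R\<close>, which is
    \<open>\<epsilon> / 2 * K\<close>; so \<open>\<bar>g\<bar> > K\<close> makes it less than
    \<open>\<epsilon> / 2\<close> relative to \<open>g\<close>.\<close>
  define K where "K = 2 * (b + ?N * R) / \<epsilon>"
  have "0 < b" by (simp add: b_def add_nonneg_pos)
  then have K: "0 < K"
    using R eps by (simp add: K_def add_pos_pos)
  have "((\<lambda>i. 2 * K / sqrt (w i \<bullet> (C i *v w i))) \<longlongrightarrow> 0) G"
    by (intro tendsto_divide_0[OF tendsto_const] filterlim_at_top_imp_at_infinity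
        filterlim_compose[OF sqrt_at_top var])
  then have ev_K: "\<forall>\<^sub>F i in G. 2 * K / sqrt (w i \<bullet> (C i *v w i)) < e / 2"
    by (rule order_tendstoD) (use e in simp)
  have ev_var: "\<forall>\<^sub>F i in G. 0 < w i \<bullet> (C i *v w i)"
    using var by (simp add: filterlim_at_top_dense)
  have ev_v: "\<forall>\<^sub>F i in G. dist (v i) v0 < \<epsilon> / 2"
    using v eps by (intro tendstoD) auto
  show "\<forall>\<^sub>F i in G. dist (measure (\<Omega> i) {\<omega> \<in> space (\<Omega> i). \<not> (w i \<bullet> x i \<omega> \<noteq> 0 \<and>
      dist (inverse (w i \<bullet> x i \<omega>) *\<^sub>R x i \<omega>) v0 < \<epsilon>)}) 0 < e"
    using prob gauss S(2) ev_b ev_K ev_var ev_v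
  proof eventually_elim
    case (elim i)
    interpret prob_space "\<Omega> i" by (rule elim)
    have [measurable]: "z i \<in> borel_measurable (\<Omega> i)"
      using elim by (simp add: gaussian_vector_def)
    define A where "A = {\<omega> \<in> space (\<Omega> i). \<bar>w i \<bullet> a i + w i \<bullet> z i \<omega>\<bar> \<le> K}"
    \<comment> \<open>The vector \<open>axis j 1 v* Q i\<close> is row \<open>j\<close> of
      \<open>Q i\<close>, so the functional is coordinate \<open>j\<close> of
      \<open>Q z\<close>.\<close>
    define B where "B j = {\<omega> \<in> space (\<Omega> i). R \<le> \<bar>(axis j 1 v* Q i) \<bullet> z i \<omega>\<bar>}" for j
    have [measurable]: "A \<in> sets (\<Omega> i)" "B j \<in> sets (\<Omega> i)" for j
      unfolding A_def B_def by measurable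
    have "prob A \<le> 2 * K / sqrt (w i \<bullet> (C i *v w i))"
      unfolding A_def by (rule gaussian_vector_small_ball) (use elim K in auto)
    then have A: "prob A < e / 2" using elim by simp
    have B: "prob (B j) \<le> S / R\<^sup>2" for j
    proof -
      let ?u = "axis j 1 v* Q i"
      have "prob (B j) \<le> ?u \<bullet> (C i *v ?u) / R\<^sup>2"
        unfolding B_def by (rule gaussian_vector_tail) (use elim R in auto)
      \<comment> \<open>The variance of this coordinate is a diagonal entry of the projected
        covariance, bounded by its norm.\<close>
      also have "?u \<bullet> (C i *v ?u) = axis j 1 \<bullet> ((Q i ** C i ** transpose (Q i)) *v axis j 1)"
        by (simp add: dot_lmul_matrix matrix_vector_mul_assoc[symmetric])
      also have "\<dots> = (Q i ** C i ** transpose (Q i)) $ j $ j"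
        by (simp add: matrix_vector_mult_basis inner_axis' column_def)
      also have "\<dots> \<le> norm (Q i ** C i ** transpose (Q i))"
        using Finite_Cartesian_Product.norm_nth_le[of "(Q i ** C i ** transpose (Q i)) $ j" j]
          Finite_Cartesian_Product.norm_nth_le[of "Q i ** C i ** transpose (Q i)" j] by simp
      also have "\<dots> \<le> S" using elim by (simp add: Q_def)
      finally show ?thesis by (simp add: divide_right_mono)
    qed
    have "{\<omega> \<in> space (\<Omega> i). \<not> (w i \<bullet> x i \<omega> \<noteq> 0 \<and>
        dist (inverse (w i \<bullet> x i \<omega>) *\<^sub>R x i \<omega>) v0 < \<epsilon>)} \<subseteq> A \<union> (\<Union>j\<in>UNIV. B j)"
    proof (rule subsetI, rule ccontr)
      fix \<omega>
      assume *: "\<omega> \<in> {\<omega> \<in> space (\<Omega> i). \<not> (w i \<bullet> x i \<omega> \<noteq> 0 \<and>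
        dist (inverse (w i \<bullet> x i \<omega>) *\<^sub>R x i \<omega>) v0 < \<epsilon>)}" "\<omega> \<notin> A \<union> (\<Union>j\<in>UNIV. B j)"
      define g where "g = w i \<bullet> x i \<omega>"
      have g: "K < \<bar>g\<bar>"
        using * by (auto simp: A_def g_def x_def inner_add_right)
      with K have g0: "g \<noteq> 0" by auto
      have "norm (Q i *v z i \<omega>) \<le> (\<Sum>j\<in>UNIV. \<bar>(Q i *v z i \<omega>) $ j\<bar>)"
        by (rule norm_le_l1_cart)
      also have "\<dots> \<le> (\<Sum>j\<in>(UNIV :: 'n set). R)"
      proof (rule sum_mono)
        fix j
        have "(Q i *v z i \<omega>) $ j = (axis j 1 v* Q i) \<bullet> z i \<omega>"
          by (simp add: dot_lmul_matrix inner_axis')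
        then show "\<bar>(Q i *v z i \<omega>) $ j\<bar> \<le> R"
          using * by (auto simp: B_def not_le intro: less_imp_le)
      qed
      finally have r: "norm (Q i *v z i \<omega>) \<le> ?N * R" by simp
      have Qmult: "Q i *v y = y - (w i \<bullet> y) *\<^sub>R v i" for y
        by (simp add: Q_def matrix_vector_mult_diff_rdistrib outer_mult_vector)
      have "Q i *v x i \<omega> = Q i *v a i + Q i *v z i \<omega>"
        by (simp add: x_def matrix_vector_right_distrib)
      then have "norm (Q i *v x i \<omega>) \<le> norm (Q i *v a i) + norm (Q i *v z i \<omega>)"
        by (metis norm_triangle_ineq)
      also have "\<dots> < b + ?N * R"
        using elim r by (simp add: Qmult)
      finally have "norm (Q i *v x i \<omega>) < \<epsilon> / 2 * K"
        using eps by (simp add: K_def)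
      also have "\<dots> \<le> \<epsilon> / 2 * \<bar>g\<bar>"
        using g eps by (intro mult_left_mono) auto
      finally have Qx: "norm (Q i *v x i \<omega>) / \<bar>g\<bar> < \<epsilon> / 2"
        using g0 by (simp add: field_simps)
      \<comment> \<open>The decomposition \<open>x = g v + Q x\<close> divided by
        \<open>g\<close>.\<close>
      have "inverse g *\<^sub>R x i \<omega> - v0 = (v i - v0) + inverse g *\<^sub>R (Q i *v x i \<omega>)"
        using g0 by (simp add: Qmult g_def[symmetric] scaleR_diff_right)
      then have "dist (inverse g *\<^sub>R x i \<omega>) v0 \<le> dist (v i) v0 + norm (inverse g *\<^sub>R (Q i *v x i \<omega>))"
        unfolding dist_norm by (metis norm_triangle_ineq)
      also have "norm (inverse g *\<^sub>R (Q i *v x i \<omega>)) = norm (Q i *v x i \<omega>) / \<bar>g\<bar>"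
        by (simp add: divide_inverse_commute)
      also have "dist (v i) v0 + norm (Q i *v x i \<omega>) / \<bar>g\<bar> < \<epsilon>"
        using Qx elim(7) by linarith
      finally show False
        using * g0 by (simp add: g_def)
    qed
    then have "prob {\<omega> \<in> space (\<Omega> i). \<not> (w i \<bullet> x i \<omega> \<noteq> 0 \<and>
        dist (inverse (w i \<bullet> x i \<omega>) *\<^sub>R x i \<omega>) v0 < \<epsilon>)} \<le> prob (A \<union> (\<Union>j\<in>UNIV. B j))"
      by (rule finite_measure_mono) measurable
    also have "\<dots> \<le> prob A + prob (\<Union>j\<in>UNIV. B j)"
      by (rule measure_Un_le) measurable
    also have "prob (\<Union>j\<in>UNIV. B j) \<le> (\<Sum>j\<in>UNIV. prob (B j))"
      by (rule measure_UNION_le) auto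
    also have "\<dots> \<le> (\<Sum>j\<in>(UNIV :: 'n set). S / R\<^sup>2)"
      by (intro sum_mono B)
    also have "\<dots> < e / 2" using Rsmall by simp
    finally show ?case using A by simp
  qed
qed

theorem theorem4p10:
  fixes F :: "real^'n \<Rightarrow> real \<Rightarrow> real^'n"
    and B :: "real^'m^'n"
    and \<alpha>0 \<alpha>c :: real
    and xs :: "real \<Rightarrow> real^'n" and xc :: "real^'n"
    and U :: "((real^'n) \<times> real) set"
    and M C :: "real \<Rightarrow> real^'n^'n"
    and l :: "real \<Rightarrow> 'n \<Rightarrow> complex" and k1 :: 'n and l1 :: "real \<Rightarrow> real" and \<delta> :: real
    and v w :: "real \<Rightarrow> real^'n" and vc wc :: "real^'n"
    and A :: "real^'n^'n"
    and \<Omega> :: "real \<Rightarrow> 'w measure" and z x :: "real \<Rightarrow> 'w \<Rightarrow> real^'n"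
    and \<gamma> :: "real \<Rightarrow> 'w \<Rightarrow> real"
  assumes N_ge_2: "CARD('n) \<ge> 2"
    and branch_interval: "\<alpha>0 < \<alpha>c"
    and F_smooth: "C2_on U (\<lambda>(y, \<alpha>). F y \<alpha>)"
    and branch_in_U: "\<forall>\<alpha>\<in>{\<alpha>0<..<\<alpha>c}. (xs \<alpha>, \<alpha>) \<in> U"
    and endpoint_in_U: "(xc, \<alpha>c) \<in> U"
    and equilibrium: "\<forall>\<alpha>\<in>{\<alpha>0<..<\<alpha>c}. F (xs \<alpha>) \<alpha> = 0"
    and stable: "\<forall>\<alpha>\<in>{\<alpha>0<..<\<alpha>c}. asymptotically_stable (\<lambda>y. F y \<alpha>) (xs \<alpha>)"
    and M_def: "M = stability_matrix F xs"
    and lyapunov: "\<forall>\<^sub>F \<alpha> in at_left \<alpha>c.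
          M \<alpha> ** C \<alpha> + C \<alpha> ** transpose (M \<alpha>) = B ** transpose B"
    and xs_limit: "(xs \<longlongrightarrow> xc) (at_left \<alpha>c)"
    and M_diagonalizable: "\<forall>\<^sub>F \<alpha> in at_left \<alpha>c. diagonalizable (complex_matrix (M \<alpha>))"
    and eigenvalues: "\<forall>\<^sub>F \<alpha> in at_left \<alpha>c. eigenvalue_family (complex_matrix (M \<alpha>)) (l \<alpha>)"
    and eigenvalues_pos: "\<forall>\<^sub>F \<alpha> in at_left \<alpha>c. \<forall>k. Re (l \<alpha> k) > 0"
    and l1_real: "\<forall>\<^sub>F \<alpha> in at_left \<alpha>c. l \<alpha> k1 = complex_of_real (l1 \<alpha>)"
    and l1_smallest: "\<forall>\<^sub>F \<alpha> in at_left \<alpha>c. \<forall>k. l1 \<alpha> \<le> Re (l \<alpha> k)"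
    and l1_simple: "\<forall>\<^sub>F \<alpha> in at_left \<alpha>c. \<forall>k. k \<noteq> k1 \<longrightarrow> l \<alpha> k \<noteq> l \<alpha> k1"
    and l1_pos: "\<forall>\<^sub>F \<alpha> in at_left \<alpha>c. l1 \<alpha> > 0"
    and l1_limit: "(l1 \<longlongrightarrow> 0) (at_left \<alpha>c)"
    and \<delta>_pos: "\<delta> > 0"
    and spectral_gap: "\<forall>\<^sub>F \<alpha> in at_left \<alpha>c. \<forall>k. k \<noteq> k1 \<longrightarrow> Re (l \<alpha> k) \<ge> \<delta>"
    and right_eigenvector: "\<forall>\<^sub>F \<alpha> in at_left \<alpha>c. M \<alpha> *v v \<alpha> = l1 \<alpha> *\<^sub>R v \<alpha>"
    and left_eigenvector: "\<forall>\<^sub>F \<alpha> in at_left \<alpha>c. w \<alpha> v* M \<alpha> = l1 \<alpha> *\<^sub>R w \<alpha>"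
    and v_normalized: "\<forall>\<^sub>F \<alpha> in at_left \<alpha>c. norm (v \<alpha>) = 1"
    and w_normalized: "\<forall>\<^sub>F \<alpha> in at_left \<alpha>c. w \<alpha> \<bullet> v \<alpha> = 1"
    and v_limit: "(v \<longlongrightarrow> vc) (at_left \<alpha>c)"
    and w_limit: "(w \<longlongrightarrow> wc) (at_left \<alpha>c)"
    and W_pos: "total_weight A > 0"
    and sigma_eff_pos: "wc \<bullet> ((B ** transpose B) *v wc) > 0"
    and rho_c_less_1: "(1 \<bullet> vc)\<^sup>2 / real CARD('n) < 1"
    and prob_spaces: "\<forall>\<^sub>F \<alpha> in at_left \<alpha>c. prob_space (\<Omega> \<alpha>)"
    and z_gaussian: "\<forall>\<^sub>F \<alpha> in at_left \<alpha>c. gaussian_vector (\<Omega> \<alpha>) (z \<alpha>) 0 (C \<alpha>)"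
    and x_def: "x = (\<lambda>\<alpha> \<omega>. xs \<alpha> + z \<alpha> \<omega>)"
    and \<gamma>_def: "\<gamma> = (\<lambda>\<alpha> \<omega>. w \<alpha> \<bullet> x \<alpha> \<omega>)"
  shows
    "tendsto_in_probability \<Omega>
       (\<lambda>\<alpha> \<omega>. spatial_skewness (x \<alpha> \<omega>) -
          sgn (\<gamma> \<alpha> \<omega>) * (spatial_moment 3 vc / spatial_moment 2 vc powr (3/2)))
       0 (at_left \<alpha>c) \<and>
     tendsto_in_probability \<Omega>
       (\<lambda>\<alpha> \<omega>. spatial_kurtosis (x \<alpha> \<omega>))
       (spatial_moment 4 vc / (spatial_moment 2 vc)\<^sup>2) (at_left \<alpha>c) \<and>
     tendsto_in_probability \<Omega>
       (\<lambda>\<alpha> \<omega>. moran_I A (x \<alpha> \<omega>))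
       (real CARD('n) / total_weight A *
          ((vc \<bullet> ((centering_matrix ** A ** centering_matrix) *v vc)) /
           (vc \<bullet> (centering_matrix *v vc)))) (at_left \<alpha>c)"
proof -
  let ?G = "at_left \<alpha>c"
  obtain J where J: "((\<lambda>\<alpha>. jacobian (\<lambda>x. F x \<alpha>) (at (xs \<alpha>))) \<longlongrightarrow> J) ?G"
    using jacobian_convergent[OF F_smooth endpoint_in_U xs_limit] by blast
  have M_limit: "(M \<longlongrightarrow> - J) ?G"
    unfolding M_def stability_matrix_def by (intro tendsto_intros J)
  obtain S where S: "0 < S" "\<forall>\<^sub>F \<alpha> in ?G.
      norm ((mat 1 - outer (v \<alpha>) (w \<alpha>)) ** C \<alpha> ** transpose (mat 1 - outer (v \<alpha>) (w \<alpha>))) \<le> S"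
    by (rule deflated_covariance_bounded[OF trivial_limit_at_left_real M_limit v_limit w_limit
          \<delta>_pos lyapunov eigenvalues l1_real l1_pos spectral_gap right_eigenvector
          left_eigenvector w_normalized]) blast
  let ?D = "B ** transpose B"
  \<comment> \<open>The variance is a quotient whose numerator tends to the positive effective noise
    intensity and whose denominator \<open>2 * l1 \<alpha>\<close> tends to 0 from above.\<close>
  have var: "filterlim (\<lambda>\<alpha>. w \<alpha> \<bullet> (C \<alpha> *v w \<alpha>)) at_top ?G"
  proof -
    have "((\<lambda>\<alpha>. w \<alpha> \<bullet> (?D *v w \<alpha>)) \<longlongrightarrow> wc \<bullet> (?D *v wc)) ?G"
      by (intro tendsto_intros w_limit bounded_linear.tendsto[OF matrix_vector_mul_bounded_linear])
    moreover have "((\<lambda>\<alpha>. 2 * l1 \<alpha>) \<longlongrightarrow> 0) ?G"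
      using tendsto_mult[OF tendsto_const l1_limit, of 2] by simp
    moreover have "\<forall>\<^sub>F \<alpha> in ?G. 0 < 2 * l1 \<alpha>"
      using l1_pos by eventually_elim simp
    ultimately have "filterlim (\<lambda>\<alpha>. w \<alpha> \<bullet> (?D *v w \<alpha>) / (2 * l1 \<alpha>)) at_top ?G"
      using sigma_eff_pos by (intro LIM_at_top_divide)
    moreover have "\<forall>\<^sub>F \<alpha> in ?G. w \<alpha> \<bullet> (?D *v w \<alpha>) / (2 * l1 \<alpha>) = w \<alpha> \<bullet> (C \<alpha> *v w \<alpha>)"
      using lyapunov left_eigenvector l1_pos
    proof eventually_elim
      case (elim \<alpha>)
      then show ?case
        using lyapunov_left_eigenvector[OF elim(1,2)] by (simp add: field_simps)
    qed
    ultimately show ?thesis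
      using filterlim_cong[OF refl refl] by fastforce
  qed
  have "((\<lambda>\<alpha>. norm (v \<alpha>)) \<longlongrightarrow> norm vc) ?G"
    by (intro tendsto_intros v_limit)
  moreover have "((\<lambda>\<alpha>. norm (v \<alpha>)) \<longlongrightarrow> 1) ?G"
    using v_normalized by (rule tendsto_eventually)
  ultimately have "norm vc = 1"
    using tendsto_unique trivial_limit_at_left_real by blast
  then have vc: "0 < spatial_moment 2 vc"
    using rho_c_less_1 by (simp add: spatial_moment_2_unit_vector)

  \<comment> \<open>Where \<open>\<gamma>\<close> vanishes, \<open>y\<close> takes the value 0
    because \<open>inverse 0 = 0\<close>; those outcomes belong to the exceptional event whose
    probability tends to 0.\<close>
  define y where "y = (\<lambda>\<alpha> \<omega>. inverse (\<gamma> \<alpha> \<omega>) *\<^sub>R x \<alpha> \<omega>)"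
  have xy: "x \<alpha> \<omega> = \<gamma> \<alpha> \<omega> *\<^sub>R y \<alpha> \<omega>" if "\<gamma> \<alpha> \<omega> \<noteq> 0" for \<alpha> \<omega>
    using that by (simp add: y_def)
  have aligned: "((\<lambda>\<alpha>. measure (\<Omega> \<alpha>) {\<omega> \<in> space (\<Omega> \<alpha>). \<not> (\<gamma> \<alpha> \<omega> \<noteq> 0 \<and> dist (y \<alpha> \<omega>) vc < \<epsilon>)}) \<longlongrightarrow> 0) ?G"
    if "0 < \<epsilon>" for \<epsilon>
    unfolding y_def \<gamma>_def x_def
    by (rule gaussian_alignment[OF prob_spaces z_gaussian xs_limit v_limit w_limit var S that])
  have x_meas: "\<forall>\<^sub>F \<alpha> in ?G. x \<alpha> \<in> borel_measurable (\<Omega> \<alpha>) \<and> \<gamma> \<alpha> \<in> borel_measurable (\<Omega> \<alpha>)"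
    using z_gaussian
  proof eventually_elim
    case (elim \<alpha>)
    then have [measurable]: "z \<alpha> \<in> borel_measurable (\<Omega> \<alpha>)"
      by (simp add: gaussian_vector_def)
    show ?case unfolding \<gamma>_def x_def by measurable
  qed
  have sets: "\<forall>\<^sub>F \<alpha> in ?G. {\<omega> \<in> space (\<Omega> \<alpha>). \<not> (\<gamma> \<alpha> \<omega> \<noteq> 0 \<and> dist (y \<alpha> \<omega>) vc < \<epsilon>)} \<in> sets (\<Omega> \<alpha>)" for \<epsilon>
    using x_meas
  proof eventually_elim
    case (elim \<alpha>)
    then have [measurable]: "x \<alpha> \<in> borel_measurable (\<Omega> \<alpha>)" "\<gamma> \<alpha> \<in> borel_measurable (\<Omega> \<alpha>)"
      by auto
    show ?case unfolding y_def by measurable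
  qed
  note mapping = tendsto_in_probability_continuous_mapping[OF _ aligned sets prob_spaces]
  show ?thesis
  proof (intro conjI)
    show "tendsto_in_probability \<Omega>
       (\<lambda>\<alpha> \<omega>. spatial_skewness (x \<alpha> \<omega>) -
          sgn (\<gamma> \<alpha> \<omega>) * (spatial_moment 3 vc / spatial_moment 2 vc powr (3/2)))
       0 ?G"
      unfolding spatial_skewness_def[symmetric]
    proof (rule mapping[OF _ _ isCont_spatial_skewness[OF vc]])
      show "\<forall>\<^sub>F \<alpha> in ?G. (\<lambda>\<omega>. spatial_skewness (x \<alpha> \<omega>) - sgn (\<gamma> \<alpha> \<omega>) * spatial_skewness vc)
          \<in> borel_measurable (\<Omega> \<alpha>)"
        using x_meas
      proof eventually_elim
        case (elim \<alpha>)
        note [measurable] = conjunct1[OF elim] conjunct2[OF elim] borel_measurable_spatial_skewness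
        show ?case unfolding sgn_if by measurable
      qed
      \<comment> \<open>For nonzero \<open>\<gamma>\<close> both terms carry the same factor
        \<open>sgn \<gamma>\<close>, which has absolute value 1, so equality holds here.\<close>
      show "\<bar>spatial_skewness (x \<alpha> \<omega>) - sgn (\<gamma> \<alpha> \<omega>) * spatial_skewness vc - 0\<bar>
          \<le> \<bar>spatial_skewness (y \<alpha> \<omega>) - spatial_skewness vc\<bar>" if "\<gamma> \<alpha> \<omega> \<noteq> 0" for \<alpha> \<omega>
        using that
        by (simp add: xy spatial_skewness_scaleR abs_mult abs_sgn_eq flip: right_diff_distrib)
    qed simp
    show "tendsto_in_probability \<Omega> (\<lambda>\<alpha> \<omega>. spatial_kurtosis (x \<alpha> \<omega>))
       (spatial_moment 4 vc / (spatial_moment 2 vc)\<^sup>2) ?G"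
      unfolding spatial_kurtosis_def[of vc, symmetric]
    proof (rule mapping[OF _ _ isCont_spatial_kurtosis[OF vc]])
      show "\<forall>\<^sub>F \<alpha> in ?G. (\<lambda>\<omega>. spatial_kurtosis (x \<alpha> \<omega>)) \<in> borel_measurable (\<Omega> \<alpha>)"
        using x_meas by eventually_elim (auto intro: measurable_compose[OF _ borel_measurable_spatial_kurtosis])
    qed (simp_all add: xy spatial_kurtosis_scaleR)
    show "tendsto_in_probability \<Omega> (\<lambda>\<alpha> \<omega>. moran_I A (x \<alpha> \<omega>))
       (real CARD('n) / total_weight A *
          ((vc \<bullet> ((centering_matrix ** A ** centering_matrix) *v vc)) /
           (vc \<bullet> (centering_matrix *v vc)))) ?G"
      \<comment> \<open>The limit is recognized as Moran's statistic of \<open>vc\<close>, so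
        continuity at \<open>vc\<close> applies.\<close>
      unfolding moran_I_centering_matrix[symmetric]
    proof (rule mapping[OF _ _ isCont_moran_I[OF vc, of A]])
      show "\<forall>\<^sub>F \<alpha> in ?G. (\<lambda>\<omega>. moran_I A (x \<alpha> \<omega>)) \<in> borel_measurable (\<Omega> \<alpha>)"
        using x_meas by eventually_elim (auto intro: measurable_compose[OF _ borel_measurable_moran_I])
    qed (simp_all add: xy moran_I_scaleR)
  qed
qed

end
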